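(* Let $n\ge 1$ and $m\in\mathbb{N}=\{1,2,\ldots\}$, and let $\alpha,\theta\in\mathbb{R}$ satisfy $$2m\le\alpha<2m+2\quad\text{and}\quad |\theta|\le\min\{\alpha-2m,\;2m+2-\alpha\}.$$ Let $\Phi_\alpha(x,t;\theta)$ be the fundamental solution defined by the Cauchy problem $$\begin{cases}\partial_t\Phi_\alpha(x,t;\theta)=-(-\Delta)^{\frac{\alpha}{2}}\exp\left(\frac{i\pi\theta}{2}\mathcal{H}\right)\Phi_\alpha(x,t;\theta), & (x,t)\in\mathbb{R}^n\times(0,\infty),\\[2pt] \Phi_\alpha(x,0;\theta)=\delta(x), & x\in\mathbb{R}^n.\end{cases}$$ Then, for $t>0$, $$\Phi_\alpha(x,t;\theta)=\frac12(I+\mathcal{H})K_{\alpha,n}\left(x,te^{i\frac{\pi\theta}{2}}\right)+\frac12(I-\mathcal{H})K_{\alpha,n}\left(x,te^{-i\frac{\pi\theta}{2}}\right).$$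
   Context: Clifford algebra: $C\ell_{0,n}$ is the universal real Clifford algebra of signature $(0,n)$, generated by $e_1,\ldots,e_n$ with $e_je_k+e_ke_j=-2\delta_{jk}$. A vector $\xi=(\xi_1,\ldots,\xi_n)\in\mathbb{R}^n$ is identified with $\xi=\sum_{j=1}^n\xi_je_j$, so that $\xi^2=-|\xi|^2$. All functions and distributions take values in the complexified algebra $\mathbb{C}\otimes C\ell_{0,n}$, where the imaginary unit $i$ commutes with every $e_j$. Fourier transform: $(\mathcal{F}\varphi)(\xi)=\int_{\mathbb{R}^n}\varphi(x)e^{-i\langle x,\xi\rangle}dx$, with inverse $(\mathcal{F}^{-1}\psi)(x)=(2\pi)^{-n}\int_{\mathbb{R}^n}\psi(\xi)e^{i\langle x,\xi\rangle}d\xi$, applied componentwise and extended to $\mathbb{C}\otimes C\ell_{0,n}$-valued tempered distributions on $\mathbb{R}^n$. Operators (Fourier multipliers acting by left multiplication): $(-\Delta)^{\alpha/2}=\mathcal{F}^{-1}|\xi|^\alpha\mathcal{F}$; the Riesz-Hilbert transform is $\mathcal{H}=\mathcal{F}^{-1}\frac{-i\xi}{|\xi|}\mathcal{F}$; $I$ is the identity; and $\exp\left(\frac{i\pi\theta}{2}\mathcal{H}\right)=\sum_{k\ge0}\frac{1}{k!}\left(\frac{i\pi\theta}{2}\right)^k\mathcal{H}^k$, i.e. the operator with Fourier multiplier $\exp\left(\frac{i\pi\theta}{2}\cdot\frac{-i\xi}{|\xi|}\right)$. Kernel: for $\tau\in\mathbb{C}$ with $\Re(\tau)\ge0$, $K_{\alpha,n}(\cdot,\tau)=\mathcal{F}^{-1}\left(e^{-\tau|\xi|^\alpha}\right)$,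 i.e. $K_{\alpha,n}(x,\tau)=(2\pi)^{-n}\int_{\mathbb{R}^n}e^{-\tau|\xi|^\alpha}e^{i\langle x,\xi\rangle}d\xi$ (understood in the sense of tempered distributions when $\Re(\tau)=0$). Under the stated conditions $|\theta|\le1$, so $\Re\left(te^{\pm i\pi\theta/2}\right)\ge0$. Meaning of the Cauchy problem: it is understood on the Fourier side. The fundamental solution is the family of tempered distributions $\Phi_\alpha(\cdot,t;\theta)$, $t\ge0$, whose Fourier transforms in $x$ are functions of $\xi$ such that, for almost every $\xi\in\mathbb{R}^n$, $t\mapsto\mathcal{F}(\Phi_\alpha(\cdot,t;\theta))(\xi)$ is continuous on $[0,\infty)$, differentiable on $(0,\infty)$, satisfies $\partial_t\mathcal{F}(\Phi_\alpha(\cdot,t;\theta))(\xi)=-|\xi|^\alpha\exp\left(\frac{i\pi\theta}{2}\cdot\frac{-i\xi}{|\xi|}\right)\mathcal{F}(\Phi_\alpha(\cdot,t;\theta))(\xi)$ for $t>0$, and equals $1$ at $t=0$. *)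

theory Defs
  imports "HOL-Analysis.Analysis"
begin

section \<open>The complexified Clifford algebra of signature (0,n)\<close>

text \<open>
  An element is a family of complex coefficients indexed by the subsets of the index type \<open>'n\<close>
  (so \<open>n = CARD('n)\<close>). The subset \<open>A\<close> stands for the product of the generators
  \<open>e j\<close>, \<open>j \<in> A\<close>, taken in increasing order with respect to the fixed enumeration
  \<^const>\<open>to_nat\<close> of \<open>'n\<close>. The norm is the \<open>\<ell>\<^sup>1\<close> norm of the coefficients, which is
  submultiplicative; as the space is finite-dimensional, its topology is the usual one.
\<close>

typedef ('n::finite) cclifford = "UNIV :: ('n set \<Rightarrow> complex) set"
  morphisms coeff Clifford ..

setup_lifting type_definition_cclifford

lemma cclifford_eqI: "(\<And>A. coeff x A = coeff y A) \<Longrightarrow> x = y"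
  by (simp add: coeff_inject[symmetric] fun_eq_iff)

text \<open>
  Reordering sign: \<open>e\<^sub>A e\<^sub>B = reorder_sign A B e\<^sub>C\<close> with \<open>C\<close> the symmetric difference. There is one
  factor \<open>-1\<close> for each transposition (\<open>j\<close> in \<open>A\<close> strictly above \<open>k\<close> in \<open>B\<close>) and one for each
  square \<open>e\<^sub>j\<^sup>2 = -1\<close> (\<open>j = k\<close>).
\<close>

definition reorder_sign :: "'n::finite set \<Rightarrow> 'n set \<Rightarrow> complex" where
  "reorder_sign A B = (\<Prod>j\<in>A. \<Prod>k\<in>B. if to_nat k \<le> to_nat j then - 1 else 1)"

lemma reorder_sign_empty [simp]: "reorder_sign {} B = 1" "reorder_sign A {} = 1"
  by (simp_all add: reorder_sign_def)

lemma norm_reorder_sign [simp]: "norm (reorder_sign A B) = 1"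
  unfolding reorder_sign_def prod_norm[symmetric]
  by (intro prod.neutral ballI) simp

lemma prod_sym_diff_sign:
  fixes f :: "'n::finite \<Rightarrow> complex"
  assumes "\<And>j. f j * f j = 1"
  shows "prod f (sym_diff A B) = prod f A * prod f B"
proof -
  have A: "prod f A = prod f (A - B) * prod f (A \<inter> B)"
    by (subst prod.union_disjoint[symmetric]) (auto intro: arg_cong[where f = "prod f"])
  have B: "prod f B = prod f (B - A) * prod f (A \<inter> B)"
    by (subst prod.union_disjoint[symmetric]) (auto intro: arg_cong[where f = "prod f"])
  have C: "prod f (A \<inter> B) * prod f (A \<inter> B) = 1"
    using assms by (simp add: prod.distrib[symmetric])
  have D: "prod f (sym_diff A B) = prod f (A - B) * prod f (B - A)"
    by (subst prod.union_disjoint) auto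
  show ?thesis
    unfolding A B D using C by (simp add: algebra_simps)
qed

lemma reorder_sign_sym_diff_left:
  "reorder_sign (sym_diff A B) C = reorder_sign A C * reorder_sign B C"
  unfolding reorder_sign_def
  by (rule prod_sym_diff_sign) (subst prod.distrib[symmetric], rule prod.neutral, simp)

lemma reorder_sign_sym_diff_right:
  "reorder_sign A (sym_diff B C) = reorder_sign A B * reorder_sign A C"
proof -
  have "(\<Prod>k\<in>sym_diff B C. if to_nat k \<le> to_nat j then - 1 else 1 :: complex) =
     (\<Prod>k\<in>B. if to_nat k \<le> to_nat j then - 1 else 1) *
     (\<Prod>k\<in>C. if to_nat k \<le> to_nat j then - 1 else 1)" for j :: 'a
    by (rule prod_sym_diff_sign) simp
  then show ?thesis
    by (simp add: reorder_sign_def prod.distrib)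
qed

instantiation cclifford :: (finite) real_vector
begin

lift_definition zero_cclifford :: "'a cclifford" is "\<lambda>_. 0" .
lift_definition plus_cclifford :: "'a cclifford \<Rightarrow> 'a cclifford \<Rightarrow> 'a cclifford"
  is "\<lambda>x y A. x A + y A" .
lift_definition minus_cclifford :: "'a cclifford \<Rightarrow> 'a cclifford \<Rightarrow> 'a cclifford"
  is "\<lambda>x y A. x A - y A" .
lift_definition uminus_cclifford :: "'a cclifford \<Rightarrow> 'a cclifford"
  is "\<lambda>x A. - x A" .
lift_definition scaleR_cclifford :: "real \<Rightarrow> 'a cclifford \<Rightarrow> 'a cclifford"
  is "\<lambda>r x A. r *\<^sub>R x A" .

instance
  by standard (transfer; simp add: fun_eq_iff algebra_simps)+

end

lemmas coeff_simps [simp] =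
  zero_cclifford.rep_eq plus_cclifford.rep_eq minus_cclifford.rep_eq
  uminus_cclifford.rep_eq scaleR_cclifford.rep_eq

instantiation cclifford :: (finite) real_normed_vector
begin

definition norm_cclifford :: "'a cclifford \<Rightarrow> real" where
  "norm_cclifford x = (\<Sum>A\<in>UNIV. norm (coeff x A))"
definition sgn_cclifford :: "'a cclifford \<Rightarrow> 'a cclifford" where
  "sgn_cclifford x = x /\<^sub>R norm x"
definition dist_cclifford :: "'a cclifford \<Rightarrow> 'a cclifford \<Rightarrow> real" where
  "dist_cclifford x y = norm (x - y)"
definition uniformity_cclifford :: "('a cclifford \<times> 'a cclifford) filter" where
  "uniformity_cclifford = (INF e\<in>{0<..}. principal {(x, y). dist x y < e})"
definition open_cclifford :: "'a cclifford set \<Rightarrow> bool" where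
  "open_cclifford U = (\<forall>x\<in>U. eventually (\<lambda>(x', y). x' = x \<longrightarrow> y \<in> U) uniformity)"

instance
proof
  fix x y :: "'a cclifford" and r :: real
  show "norm x = 0 \<longleftrightarrow> x = 0"
    by (auto simp: norm_cclifford_def sum_nonneg_eq_0_iff intro: cclifford_eqI)
  show "norm (x + y) \<le> norm x + norm y"
    by (simp add: norm_cclifford_def sum.distrib[symmetric] sum_mono norm_triangle_ineq)
  show "norm (r *\<^sub>R x) = \<bar>r\<bar> * norm x"
    by (simp add: norm_cclifford_def sum_distrib_left)
qed (simp_all add: sgn_cclifford_def dist_cclifford_def uniformity_cclifford_def
       open_cclifford_def)

end

lemma norm_coeff_le: "norm (coeff x A) \<le> norm x"
  unfolding norm_cclifford_def by (rule member_le_sum) auto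

instantiation cclifford :: (finite) real_normed_algebra_1
begin

lift_definition one_cclifford :: "'a cclifford" is "\<lambda>A. if A = {} then 1 else 0" .
lift_definition times_cclifford :: "'a cclifford \<Rightarrow> 'a cclifford \<Rightarrow> 'a cclifford"
  is "\<lambda>x y C. \<Sum>A\<in>UNIV. \<Sum>B\<in>UNIV.
        if sym_diff A B = C then reorder_sign A B * x A * y B else 0" .

lemma sum_mult_coeff:
  "(\<Sum>C\<in>UNIV. w C * coeff (x * y) C) =
   (\<Sum>A\<in>UNIV. \<Sum>B\<in>UNIV. w (sym_diff A B) * (reorder_sign A B * coeff x A * coeff y B))"
proof -
  have "(\<Sum>C\<in>UNIV. w C * coeff (x * y) C) =
    (\<Sum>C\<in>UNIV. \<Sum>A\<in>UNIV. \<Sum>B\<in>UNIV. if sym_diff A B = C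
       then w C * (reorder_sign A B * coeff x A * coeff y B) else 0)"
    unfolding times_cclifford.rep_eq sum_distrib_left
    by (intro sum.cong refl) (simp add: if_distrib)
  also have "\<dots> = (\<Sum>A\<in>UNIV. \<Sum>C\<in>UNIV. \<Sum>B\<in>UNIV. if sym_diff A B = C
       then w C * (reorder_sign A B * coeff x A * coeff y B) else 0)"
    by (rule sum.swap)
  also have "\<dots> = (\<Sum>A\<in>UNIV. \<Sum>B\<in>UNIV. \<Sum>C\<in>UNIV. if sym_diff A B = C
       then w C * (reorder_sign A B * coeff x A * coeff y B) else 0)"
    by (rule sum.cong[OF refl], rule sum.swap)
  finally show ?thesis by simp
qed

instance
proof
  fix x y z :: "'a cclifford" and r :: real
  have sd: "sym_diff (sym_diff A B) C = sym_diff A (sym_diff B C)" for A B C :: "'a set"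
    by blast
  show "x * y * z = x * (y * z)"
  proof (rule cclifford_eqI)
    fix D :: "'a set"
    have "coeff (x * y * z) D = (\<Sum>E\<in>UNIV. (\<Sum>C\<in>UNIV. if sym_diff E C = D
        then reorder_sign E C * coeff z C else 0) * coeff (x * y) E)"
      unfolding times_cclifford.rep_eq[of "x * y"] sum_distrib_right
      by (intro sum.cong refl if_cong) simp
    also have "\<dots> = (\<Sum>A\<in>UNIV. \<Sum>B\<in>UNIV. (\<Sum>C\<in>UNIV. if sym_diff (sym_diff A B) C = D
        then reorder_sign (sym_diff A B) C * coeff z C else 0) *
          (reorder_sign A B * coeff x A * coeff y B))"
      by (rule sum_mult_coeff)
    also have "\<dots> = (\<Sum>A\<in>UNIV. \<Sum>B\<in>UNIV. \<Sum>C\<in>UNIV. (if sym_diff A (sym_diff B C) = D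
        then reorder_sign A (sym_diff B C) * coeff x A else 0) *
          (reorder_sign B C * coeff y B * coeff z C))"
      unfolding sum_distrib_right sd reorder_sign_sym_diff_left reorder_sign_sym_diff_right
      by (intro sum.cong refl) simp
    also have "\<dots> = (\<Sum>A\<in>UNIV. \<Sum>E\<in>UNIV. (if sym_diff A E = D
        then reorder_sign A E * coeff x A else 0) * coeff (y * z) E)"
      by (rule sum.cong[OF refl], rule sum_mult_coeff[symmetric])
    also have "\<dots> = coeff (x * (y * z)) D"
      unfolding times_cclifford.rep_eq[of x] by (intro sum.cong refl) simp
    finally show "coeff (x * y * z) D = coeff (x * (y * z)) D" .
  qed
  show "(x + y) * z = x * z + y * z"
    by (rule cclifford_eqI, unfold times_cclifford.rep_eq coeff_simps sum.distrib[symmetric],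
        intro sum.cong refl) (simp add: algebra_simps)
  show "x * (y + z) = x * y + x * z"
    by (rule cclifford_eqI, unfold times_cclifford.rep_eq coeff_simps sum.distrib[symmetric],
        intro sum.cong refl) (simp add: algebra_simps)
  show "r *\<^sub>R x * y = r *\<^sub>R (x * y)"
    by (rule cclifford_eqI, unfold times_cclifford.rep_eq coeff_simps scaleR_sum_right,
        intro sum.cong refl) simp
  show "x * r *\<^sub>R y = r *\<^sub>R (x * y)"
    by (rule cclifford_eqI, unfold times_cclifford.rep_eq coeff_simps scaleR_sum_right,
        intro sum.cong refl) simp
  show "1 * x = x"
  proof (rule cclifford_eqI)
    fix D :: "'a set"
    have "coeff (1 * x) D = (\<Sum>A::'a set\<in>UNIV. \<Sum>B\<in>UNIV. if B = D then (if A = {} then coeff x B else 0) else 0)"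
      unfolding times_cclifford.rep_eq one_cclifford.rep_eq by (intro sum.cong refl) auto
    then show "coeff (1 * x) D = coeff x D" by simp
  qed
  show "x * 1 = x"
  proof (rule cclifford_eqI)
    fix D :: "'a set"
    have "coeff (x * 1) D = (\<Sum>A\<in>UNIV. \<Sum>B::'a set\<in>UNIV. if B = {} then (if A = D then coeff x A else 0) else 0)"
      unfolding times_cclifford.rep_eq one_cclifford.rep_eq by (intro sum.cong refl) auto
    then show "coeff (x * 1) D = coeff x D" by simp
  qed
  have "coeff (0::'a cclifford) {} \<noteq> coeff 1 {}"
    unfolding one_cclifford.rep_eq by simp
  then show "(0::'a cclifford) \<noteq> 1" by metis
  show "norm (x * y) \<le> norm x * norm y"
  proof -
    have "norm (x * y) \<le> (\<Sum>C\<in>UNIV. \<Sum>A\<in>UNIV. \<Sum>B\<in>UNIV. if sym_diff A B = C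
        then norm (coeff x A) * norm (coeff y B) else 0)"
      unfolding norm_cclifford_def times_cclifford.rep_eq
      by (intro sum_mono order.trans[OF norm_sum]) (auto simp: norm_mult)
    also have "\<dots> = (\<Sum>A\<in>UNIV. \<Sum>C\<in>UNIV. \<Sum>B\<in>UNIV. if sym_diff A B = C
        then norm (coeff x A) * norm (coeff y B) else 0)"
      by (rule sum.swap)
    also have "\<dots> = (\<Sum>A\<in>UNIV. \<Sum>B\<in>UNIV. \<Sum>C\<in>UNIV. if sym_diff A B = C
        then norm (coeff x A) * norm (coeff y B) else 0)"
      by (rule sum.cong[OF refl], rule sum.swap)
    also have "\<dots> = norm x * norm y"
      by (simp add: norm_cclifford_def sum_product)
    finally show ?thesis .
  qed
  have "norm (1::'a cclifford) = (\<Sum>A::'a set\<in>UNIV. if A = {} then 1 else 0)"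
    unfolding norm_cclifford_def one_cclifford.rep_eq by (intro sum.cong refl) simp
  then show "norm (1::'a cclifford) = 1" by simp
qed

end

lemma bounded_linear_coeff: "bounded_linear (\<lambda>x. coeff x A)"
  by (rule bounded_linear_intro[where K = 1]) (simp_all add: norm_coeff_le)

lemma tendsto_ccliffordI:
  assumes "\<And>A. ((\<lambda>n. coeff (X n) A) \<longlongrightarrow> coeff L A) F"
  shows "(X \<longlongrightarrow> L) F"
proof -
  have "((\<lambda>n. \<Sum>A\<in>UNIV. norm (coeff (X n) A - coeff L A)) \<longlongrightarrow> (\<Sum>A::'a set\<in>UNIV. 0)) F"
    by (intro tendsto_sum tendsto_norm_zero) (use assms in \<open>simp add: LIM_zero\<close>)
  then have "((\<lambda>n. norm (X n - L)) \<longlongrightarrow> 0) F"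
    by (simp add: norm_cclifford_def)
  then show ?thesis
    using tendsto_norm_zero_iff LIM_zero_iff by blast
qed

instance cclifford :: (finite) banach
proof
  fix X :: "nat \<Rightarrow> 'a cclifford"
  assume "Cauchy X"
  then have "convergent (\<lambda>n. coeff (X n) A)" for A
    by (intro Cauchy_convergent bounded_linear.Cauchy[OF bounded_linear_coeff])
  then obtain l where l: "\<And>A. (\<lambda>n. coeff (X n) A) \<longlonglongrightarrow> l A"
    unfolding convergent_def by metis
  have "X \<longlonglongrightarrow> Clifford l"
    by (rule tendsto_ccliffordI) (simp add: Clifford_inverse l)
  then show "convergent X"
    by (rule convergentI)
qed

instance cclifford :: (finite) second_countable_topology
proof
  define g :: "complex ^ ('a set) \<Rightarrow> 'a cclifford" where "g v = Clifford (\<lambda>A. v $ A)" for v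
  define h :: "'a cclifford \<Rightarrow> complex ^ ('a set)" where "h x = (\<chi> A. coeff x A)" for x
  have gh: "g (h x) = x" for x
    by (simp add: g_def h_def coeff_inverse)
  have hg: "h (g v) = v" for v
    by (simp add: g_def h_def Clifford_inverse)
  have cont_g: "continuous_on UNIV g"
    unfolding continuous_on_def g_def
    by (auto intro!: tendsto_ccliffordI tendsto_vec_nth simp: Clifford_inverse)
  have cont_h: "continuous_on UNIV h"
    unfolding continuous_on_def h_def
    by (auto intro!: tendsto_vec_lambda bounded_linear.tendsto[OF bounded_linear_coeff])
  have img: "g ` U = h -` U" for U
    by (auto simp: hg image_iff) (metis gh)
  obtain B :: "(complex ^ ('a set)) set set" where B: "countable B" "topological_basis B"
    using ex_countable_basis by blast
  have "topological_basis ((`) g ` B)"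
  proof (rule topological_basisI)
    fix U assume "U \<in> (`) g ` B"
    then show "open U"
      using B(2) cont_h by (auto simp: img topological_basis_open intro: open_vimage)
  next
    fix U :: "'a cclifford set" and x assume "open U" "x \<in> U"
    then have "open (g -` U)" "h x \<in> g -` U"
      using cont_g by (auto intro: open_vimage simp: gh)
    then obtain V where V: "V \<in> B" "h x \<in> V" "V \<subseteq> g -` U"
      using B(2) topological_basisE by metis
    have "x \<in> g ` V" using V(2) gh by (metis imageI)
    moreover have "g ` V \<subseteq> U" using V(3) by blast
    ultimately show "\<exists>V\<in>(`) g ` B. x \<in> V \<and> V \<subseteq> U"
      using V(1) by blast
  qed
  then show "\<exists>B::'a cclifford set set. countable B \<and> open = generate_topology B"
    using B(1) topological_basis_imp_subbasis by blast
qed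

text \<open>
  The copy \<open>z \<mapsto> z \<cdot> 1\<close> of the complex numbers in the algebra; it is central, so multiplication by
  \<open>cscalar z\<close> is multiplication by the complex scalar \<open>z\<close>.
\<close>

lift_definition cscalar :: "complex \<Rightarrow> 'n::finite cclifford" is "\<lambda>z A. if A = {} then z else 0" .

lift_definition blade :: "'n set \<Rightarrow> 'n::finite cclifford" is "\<lambda>A B. if B = A then 1 else 0" .

definition clifford_gen :: "'n \<Rightarrow> 'n::finite cclifford" where
  "clifford_gen j = blade {j}"

definition clifford_vec :: "real ^ 'n \<Rightarrow> 'n::finite cclifford" where
  "clifford_vec \<xi> = (\<Sum>j\<in>UNIV. (\<xi> $ j) *\<^sub>R clifford_gen j)"

text \<open>
  The next facts identify the algebra: \<open>\<complex>\<close> is central, the generators satisfy the Clifford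
  relations, and the \<open>2\<^sup>n\<close> basis elements are the ordered products of the generators.
\<close>

lemma coeff_cscalar_mult [simp]: "coeff (cscalar z * x) C = z * coeff x C"
proof -
  have "coeff (cscalar z * x) C =
      (\<Sum>A::'a set\<in>UNIV. \<Sum>B\<in>UNIV. if B = C then (if A = {} then z * coeff x B else 0) else 0)"
    unfolding times_cclifford.rep_eq cscalar.rep_eq by (intro sum.cong refl) auto
  then show ?thesis by simp
qed

lemma cscalar_commute: "cscalar z * x = x * cscalar z"
proof (rule cclifford_eqI)
  fix C :: "'a set"
  have "coeff (x * cscalar z) C =
      (\<Sum>A\<in>UNIV. \<Sum>B::'a set\<in>UNIV. if B = {} then (if A = C then z * coeff x A else 0) else 0)"
    unfolding times_cclifford.rep_eq cscalar.rep_eq by (intro sum.cong refl) auto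
  then show "coeff (cscalar z * x) C = coeff (x * cscalar z) C" by simp
qed

lemma cscalar_add: "cscalar (z + w) = cscalar z + cscalar w"
  by (rule cclifford_eqI) (simp add: cscalar.rep_eq)

lemma cscalar_mult: "cscalar (z * w) = cscalar z * cscalar w"
  by (rule cclifford_eqI) (simp add: cscalar.rep_eq)

lemma cscalar_of_real: "cscalar (of_real r) = of_real r"
  by (rule cclifford_eqI) (simp add: cscalar.rep_eq of_real_def one_cclifford.rep_eq)

lemma clifford_basis: "x = (\<Sum>A\<in>UNIV. cscalar (coeff x A) * blade A)"
proof (rule cclifford_eqI)
  fix B :: "'a set"
  have sum: "coeff (\<Sum>A\<in>S. f A) B = (\<Sum>A\<in>S. coeff (f A) B)" for S :: "'a set set" and f
    by (rule linear_sum) (rule bounded_linear.linear[OF bounded_linear_coeff])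
  show "coeff x B = coeff (\<Sum>A\<in>UNIV. cscalar (coeff x A) * blade A) B"
    unfolding sum by (simp add: blade.rep_eq if_distrib cong: if_cong)
qed

lemma blade_mult: "blade A * blade B = cscalar (reorder_sign A B) * blade (sym_diff A B)"
proof (rule cclifford_eqI)
  fix C
  have "coeff (blade A * blade B) C =
    (\<Sum>A'\<in>UNIV. \<Sum>B'\<in>UNIV. if B' = B then (if A' = A then
       (if sym_diff A B = C then reorder_sign A B else 0) else 0) else 0)"
    unfolding times_cclifford.rep_eq blade.rep_eq by (intro sum.cong refl) auto
  then show "coeff (blade A * blade B) C =
      coeff (cscalar (reorder_sign A B) * blade (sym_diff A B)) C"
    by (auto simp: blade.rep_eq)
qed

lemma blade_empty: "blade {} = 1"
  by (rule cclifford_eqI) (simp add: blade.rep_eq one_cclifford.rep_eq)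

lemma blade_insert:
  assumes "\<And>k. k \<in> A \<Longrightarrow> to_nat j < to_nat k"
  shows "blade (insert j A) = clifford_gen j * blade A"
proof -
  have "reorder_sign {j} A = 1"
    unfolding reorder_sign_def using assms by (auto intro!: prod.neutral simp: not_le)
  moreover have "sym_diff {j} A = insert j A"
    using assms by force
  ultimately show ?thesis
    using cscalar_of_real[of 1, where 'a = 'a] by (simp add: clifford_gen_def blade_mult)
qed

lemma clifford_relations:
  "clifford_gen (j :: 'a :: finite) * clifford_gen k + clifford_gen k * clifford_gen j = (if j = k then - 2 else 0)"
proof (rule cclifford_eqI)
  fix C :: "'a set"
  have s: "sym_diff {k} {j} = sym_diff {j} {k}" by auto
  have two: "(2 :: 'a cclifford) = cscalar 2"
    using cscalar_of_real[of 2, where 'a = 'a] by simp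
  have m: "coeff (2 :: 'a cclifford) C = (if C = {} then 2 else 0)"
    unfolding two by (simp add: cscalar.rep_eq)
  show "coeff (clifford_gen j * clifford_gen k + clifford_gen k * clifford_gen j) C =
     coeff (if j = k then - 2 else 0 :: 'a cclifford) C"
  proof (cases "j = k")
    case True
    then show ?thesis by (simp add: clifford_gen_def blade_mult m blade.rep_eq reorder_sign_def)
  next
    case False
    then have "to_nat j < to_nat k \<or> to_nat k < to_nat j"
      using to_nat_split[of j k] by linarith
    then show ?thesis
      using False by (auto simp: clifford_gen_def blade_mult s blade.rep_eq reorder_sign_def)
  qed
qed


section \<open>Tempered distributions with values in the algebra\<close>

fun partials :: "'n list \<Rightarrow> (real ^ 'n \<Rightarrow> complex) \<Rightarrow> real ^ 'n::finite \<Rightarrow> complex" where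
  "partials [] \<phi> = \<phi>"
| "partials (j # js) \<phi> = (\<lambda>x. frechet_derivative (partials js \<phi>) (at x) (axis j 1))"

definition schwartz :: "(real ^ 'n::finite \<Rightarrow> complex) set" where
  "schwartz = {\<phi>. (\<forall>js x. partials js \<phi> differentiable (at x)) \<and>
     (\<forall>js k. bounded (range (\<lambda>x. (1 + norm x) ^ k * norm (partials js \<phi> x))))}"

text \<open>An increasing sequence of seminorms generating the usual Frechet topology of the Schwartz space.\<close>

definition schwartz_norm :: "nat \<Rightarrow> (real ^ 'n::finite \<Rightarrow> complex) \<Rightarrow> real" where
  "schwartz_norm N \<phi> = (SUP (js, x)\<in>{js. length js \<le> N} \<times> UNIV. (1 + norm x) ^ N * norm (partials js \<phi> x))"

text \<open>
  A distribution is a complex-linear functional on (scalar) Schwartz functions. Its values off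
  \<^const>\<open>schwartz\<close> carry no meaning, so two distributions are equal when they agree on
  \<^const>\<open>schwartz\<close>.
\<close>

type_synonym 'n cdist = "(real ^ 'n \<Rightarrow> complex) \<Rightarrow> 'n cclifford"

definition tempered_distribution :: "'n::finite cdist \<Rightarrow> bool" where
  "tempered_distribution T \<longleftrightarrow>
     (\<forall>\<phi>\<in>schwartz. \<forall>\<psi>\<in>schwartz. T (\<lambda>x. \<phi> x + \<psi> x) = T \<phi> + T \<psi>) \<and>
     (\<forall>c. \<forall>\<phi>\<in>schwartz. T (\<lambda>x. c * \<phi> x) = cscalar c * T \<phi>) \<and>
     (\<exists>C N. \<forall>\<phi>\<in>schwartz. norm (T \<phi>) \<le> C * schwartz_norm N \<phi>)"

definition regular_dist :: "(real ^ 'n \<Rightarrow> 'n cclifford) \<Rightarrow> 'n::finite cdist" where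
  "regular_dist f = (\<lambda>\<phi>. \<integral>x. f x * cscalar (\<phi> x) \<partial>lborel)"

definition fourier :: "(real ^ 'n \<Rightarrow> complex) \<Rightarrow> real ^ 'n::finite \<Rightarrow> complex" where
  "fourier \<phi> \<xi> = (\<integral>x. \<phi> x * exp (- (\<i> * of_real (x \<bullet> \<xi>))) \<partial>lborel)"

definition inv_fourier :: "(real ^ 'n \<Rightarrow> complex) \<Rightarrow> real ^ 'n::finite \<Rightarrow> complex" where
  "inv_fourier \<psi> x =
     of_real (1 / (2 * pi) ^ CARD('n)) * (\<integral>\<xi>. \<psi> \<xi> * exp (\<i> * of_real (x \<bullet> \<xi>)) \<partial>lborel)"

definition fourier_dist :: "'n::finite cdist \<Rightarrow> 'n cdist" where
  "fourier_dist T = (\<lambda>\<phi>. T (fourier \<phi>))"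

definition inv_fourier_dist :: "'n::finite cdist \<Rightarrow> 'n cdist" where
  "inv_fourier_dist T = (\<lambda>\<phi>. T (inv_fourier \<phi>))"

definition has_fourier_function ::
    "'n::finite cdist \<Rightarrow> (real ^ 'n \<Rightarrow> 'n cclifford) \<Rightarrow> bool" where
  "has_fourier_function T f \<longleftrightarrow>
     (\<forall>\<phi>\<in>schwartz. integrable lborel (\<lambda>x. f x * cscalar (\<phi> x)) \<and>
        fourier_dist T \<phi> = regular_dist f \<phi>)"


section \<open>Fourier multipliers, the kernel and the Cauchy problem\<close>

text \<open>
  The symbols below are not smooth at the origin, so the multiplier operator makes sense for
  distributions whose Fourier transform is a function. That function is determined up to a null
  set, and the result does not depend on the representative chosen.
\<close>

definition fourier_multiplier :: "(real ^ 'n \<Rightarrow> 'n cclifford) \<Rightarrow> 'n::finite cdist \<Rightarrow> 'n cdist" where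
  "fourier_multiplier \<sigma> T =
     inv_fourier_dist (regular_dist (\<lambda>\<xi>. \<sigma> \<xi> * (SOME f. has_fourier_function T f) \<xi>))"

text \<open>\<open>- i \<xi> / |\<xi>|\<close>, with the irrelevant value 0 at the origin.\<close>

definition riesz_hilbert_symbol :: "real ^ 'n \<Rightarrow> 'n::finite cclifford" where
  "riesz_hilbert_symbol \<xi> = cscalar (- \<i>) * clifford_vec \<xi> /\<^sub>R norm \<xi>"

definition riesz_hilbert :: "'n::finite cdist \<Rightarrow> 'n cdist" where
  "riesz_hilbert = fourier_multiplier riesz_hilbert_symbol"

text \<open>The symbol of \<open>(-\<Delta>)\<^bsup>\<alpha>/2\<^esup> exp (i \<pi> \<theta> / 2 \<H>)\<close>.\<close>

definition generator_symbol :: "real \<Rightarrow> real \<Rightarrow> real ^ 'n \<Rightarrow> 'n::finite cclifford" where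
  "generator_symbol \<alpha> \<theta> \<xi> =
     (norm \<xi> powr \<alpha>) *\<^sub>R exp (cscalar (\<i> * pi * \<theta> / 2) * riesz_hilbert_symbol \<xi>)"

definition frac_heat_kernel :: "real \<Rightarrow> complex \<Rightarrow> 'n::finite cdist" where
  "frac_heat_kernel \<alpha> \<tau> =
     inv_fourier_dist (regular_dist (\<lambda>\<xi>. cscalar (exp (- \<tau> * of_real (norm \<xi> powr \<alpha>)))))"

text \<open>
  The Cauchy problem \<open>\<partial>\<^sub>t \<Phi> = - (-\<Delta>)\<^bsup>\<alpha>/2\<^esup> exp (i \<pi> \<theta> / 2 \<H>) \<Phi>\<close>, \<open>\<Phi>(0) = \<delta>\<close>, on the Fourier side.
  \<open>F t\<close> is a pointwise defined Fourier transform of \<open>\<Phi> t\<close>; the exceptional null set of \<open>\<xi>\<close> does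
  not depend on \<open>t\<close>.
\<close>

definition fundamental_solution :: "real \<Rightarrow> real \<Rightarrow> (real \<Rightarrow> 'n::finite cdist) \<Rightarrow> bool" where
  "fundamental_solution \<alpha> \<theta> \<Phi> \<longleftrightarrow>
     (\<forall>t\<ge>0. tempered_distribution (\<Phi> t)) \<and>
     (\<exists>F. (\<forall>t\<ge>0. has_fourier_function (\<Phi> t) (F t)) \<and>
       (AE \<xi> in lborel.
          continuous_on {0..} (\<lambda>t. F t \<xi>) \<and>
          (\<forall>t>0. ((\<lambda>s. F s \<xi>) has_vector_derivative
             - (generator_symbol \<alpha> \<theta> \<xi> * F t \<xi>)) (at t)) \<and>
          F 0 \<xi> = 1))"

end

theory Submission
  imports Defs "HOL-Probability.Characteristic_Functions" "HOL-Probability.Sinc_Integral"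
begin

text \<open>
  The symbol \<open>\<sigma> = - i \<xi> / |\<xi>|\<close> squares to \<open>1\<close>, so \<open>P\<^sub>\<plusminus> = (1 \<plusminus> \<sigma>) / 2\<close> are complementary
  idempotents and \<open>exp (i \<pi> \<theta> \<sigma> / 2) = exp (i \<pi> \<theta> / 2) P\<^sub>+ + exp (- i \<pi> \<theta> / 2) P\<^sub>-\<close>. The
  Cauchy problem is, for almost every \<open>\<xi>\<close>, a linear differential equation in the algebra whose
  unique solution is therefore \<open>exp (- t exp (i \<pi> \<theta> / 2) |\<xi>|\<^sup>\<alpha>) P\<^sub>+ + exp (- t exp (- i \<pi> \<theta> / 2) |\<xi>|\<^sup>\<alpha>) P\<^sub>-\<close>;
  it is bounded because \<open>|\<theta>| \<le> 1\<close>. Fourier inversion on the Schwartz space transports this identity to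
  the distributions. Since the symbols are not smooth at the origin, the multiplier operators depend
  on the Fourier transform being determined almost everywhere by its action on Schwartz functions.
\<close>

section \<open>The Schwartz space\<close>

text \<open>Two choices in the definitions force most of the analysis. A multiplier operator acts on
  a representative of the Fourier transform picked by \<open>SOME\<close>, about which only its
  integrals against Schwartz functions are known; measurability and uniqueness almost everywhere
  must be recovered from these before the symbol can be applied. And since \<open>schwartz\<close>
  is the only class of test functions, the Fourier transform must be shown to map it into itself,
  with seminorm bounds, for inversion to act on distributions. Bump functions are avoided: products
  \<open>q exp (- r)\<close> with polynomials \<open>q\<close>, \<open>r\<close> are stable under
  differentiation, and limits of them are rich enough to detect every box. The algebra is not
  commutative, so the position of factors matters: the symbol acts from the left, while kernel
  values and test functions are central scalars. The differential equation holds only for t > 0 and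
  almost every \<xi>, but the exceptional set is common to all t; this allows it to be solved
  separately for each remaining \<xi>, with continuity at 0 bringing in the initial value.\<close>

lemma partials_append: "partials (js @ ks) \<phi> = partials js (partials ks \<phi>)"
  by (induction js) auto

lemma partials_singleton_eqI:
  assumes "\<And>x. (f has_derivative f' x) (at x)"
  shows "partials [j] f = (\<lambda>x. f' x (axis j 1))"
  using frechet_derivative_at[OF assms] by (simp add: partials.simps)

declare partials.simps(2) [simp del]

lemma sum_of_real_axis:
  "(\<Sum>i\<in>UNIV. of_real (axis j 1 $ i) * f i) = (f (j :: 'n::finite) :: complex)"
  by (simp add: axis_def if_distrib[of of_real] if_distrib[of "\<lambda>c. c * _"] cong: if_cong)

lemma has_derivative_iexp_inner:
  fixes x v :: "'a::real_inner"
  shows "((\<lambda>x. exp (\<i> * of_real (x \<bullet> v))) has_derivative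
    (\<lambda>h. \<i> * of_real (h \<bullet> v) * exp (\<i> * of_real (x \<bullet> v)))) (at x)"
proof -
  have "((\<lambda>x. \<i> * of_real (x \<bullet> v)) has_derivative (\<lambda>h. \<i> * of_real (h \<bullet> v))) (at x)"
    by (intro bounded_linear_imp_has_derivative bounded_linear_compose[OF bounded_linear_mult_right]
        bounded_linear_compose[OF bounded_linear_of_real] bounded_linear_inner_left)
  from has_derivative_compose[OF this DERIV_exp[unfolded has_field_derivative_def]]
  show ?thesis by (simp add: mult_ac)
qed

text \<open>Writing the total derivative through partials turns the sum and product rules for
  \<open>has_derivative\<close> into formulas for \<open>partials\<close>; evaluation at
  \<open>axis j 1\<close> leaves one summand.\<close>

lemma partials_has_derivative:
  assumes "f differentiable (at x)"
  shows "(f has_derivative (\<lambda>h. \<Sum>j\<in>UNIV. of_real (h $ j) * partials [j] f x)) (at x)"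
proof -
  have D: "(f has_derivative frechet_derivative f (at x)) (at x)"
    using assms frechet_derivative_works by blast
  have "frechet_derivative f (at x) h = (\<Sum>j\<in>UNIV. of_real (h $ j) * partials [j] f x)" for h
  proof -
    have "linear (frechet_derivative f (at x))"
      using D has_derivative_linear by blast
    then have "frechet_derivative f (at x) (\<Sum>j\<in>UNIV. (h $ j) *\<^sub>R axis j 1)
        = (\<Sum>j\<in>UNIV. (h $ j) *\<^sub>R frechet_derivative f (at x) (axis j 1))"
      by (simp add: linear_sum linear_scale)
    moreover have "(\<Sum>j\<in>UNIV. (h $ j) *\<^sub>R axis j 1) = h"
      using basis_expansion[of h] by (simp add: scalar_mult_eq_scaleR)
    ultimately show ?thesis
      by (simp add: scaleR_conv_of_real partials.simps)
  qed
  then have "frechet_derivative f (at x) = (\<lambda>h. \<Sum>j\<in>UNIV. of_real (h $ j) * partials [j] f x)"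
    by blast
  then show ?thesis using D by simp
qed

lemma partials_modulate:
  assumes "\<And>x. f differentiable (at x)"
  shows "partials [j] (\<lambda>x. exp (\<i> * of_real (x \<bullet> v)) * f x) =
    (\<lambda>x. exp (\<i> * of_real (x \<bullet> v)) * partials [j] f x +
      (\<i> * of_real (v $ j)) * (exp (\<i> * of_real (x \<bullet> v)) * f x))"
  by (subst partials_singleton_eqI[OF has_derivative_mult[OF has_derivative_iexp_inner
        partials_has_derivative[OF assms]]])
    (auto simp: sum_of_real_axis inner_axis' fun_eq_iff)

text \<open>Iterated partials never need to be computed: in a set stable under single partial
  derivatives they all stay inside, so differentiability and decay have to be checked only for the
  members themselves.\<close>

lemma schwartz_coinduct:
  assumes "\<phi> \<in> S"
    and "\<And>f x. f \<in> S \<Longrightarrow> f differentiable (at x)"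
    and "\<And>f j. f \<in> S \<Longrightarrow> partials [j] f \<in> S"
    and "\<And>f k. f \<in> S \<Longrightarrow> bounded (range (\<lambda>x. (1 + norm x) ^ k * norm (f x)))"
  shows "\<phi> \<in> schwartz"
proof -
  have "partials js \<phi> \<in> S" for js
  proof (induction js)
    case (Cons j js)
    then show ?case using assms(3)[of "partials js \<phi>" j] by (simp add: partials.simps)
  qed (simp add: assms)
  then show ?thesis
    using assms by (auto simp: schwartz_def)
qed

lemma schwartz_differentiable: "\<phi> \<in> schwartz \<Longrightarrow> \<phi> differentiable (at x)"
  by (auto simp: schwartz_def dest: spec[of _ "[]"])

lemma schwartz_partials: "\<phi> \<in> schwartz \<Longrightarrow> partials js \<phi> \<in> schwartz"
  unfolding schwartz_def by (auto simp: partials_append[symmetric])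

lemma schwartz_bounded:
  "\<phi> \<in> schwartz \<Longrightarrow> bounded (range (\<lambda>x. (1 + norm x) ^ k * norm (\<phi> x)))"
  unfolding schwartz_def by (force dest: spec[of _ "[]"])

lemma schwartz_isCont: "\<phi> \<in> schwartz \<Longrightarrow> isCont \<phi> x"
  by (simp add: differentiable_imp_continuous_within schwartz_differentiable)

lemma schwartz_measurable [measurable_dest]: "\<phi> \<in> schwartz \<Longrightarrow> \<phi> \<in> borel_measurable borel"
  by (intro borel_measurable_continuous_onI continuous_at_imp_continuous_on)
    (auto simp: schwartz_isCont)

lemma bounded_range_weight_iff:
  fixes f :: "'a::real_normed_vector \<Rightarrow> 'b::real_normed_vector"
  shows "bounded (range (\<lambda>x. (1 + norm x) ^ k * norm (f x)))
    \<longleftrightarrow> (\<exists>B. \<forall>x. (1 + norm x) ^ k * norm (f x) \<le> B)"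
  by (force simp: bounded_iff)

text \<open>The closure properties are proved together because a partial derivative of a coordinate
  multiple or of a modulation mixes sums, scalar multiples, coordinate factors and modulations. The
  set generated by all of them is stable under \<open>partials\<close>, so coinduction shows that it
  adds nothing to \<open>schwartz\<close>.\<close>

inductive_set schwartz_closure :: "(real ^ 'n::finite \<Rightarrow> complex) set" where
  base: "\<phi> \<in> schwartz \<Longrightarrow> \<phi> \<in> schwartz_closure"
| add: "f \<in> schwartz_closure \<Longrightarrow> g \<in> schwartz_closure \<Longrightarrow> (\<lambda>x. f x + g x) \<in> schwartz_closure"
| const: "f \<in> schwartz_closure \<Longrightarrow> (\<lambda>x. c * f x) \<in> schwartz_closure"
| coord: "f \<in> schwartz_closure \<Longrightarrow> (\<lambda>x. of_real (x $ i) * f x) \<in> schwartz_closure"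
| modulate: "f \<in> schwartz_closure \<Longrightarrow> (\<lambda>x. exp (\<i> * of_real (x \<bullet> v)) * f x) \<in> schwartz_closure"

lemma schwartz_closure_differentiable:
  "f \<in> schwartz_closure \<Longrightarrow> f differentiable (at x)"
proof (induction arbitrary: x rule: schwartz_closure.induct)
  case (coord f i)
  have "(\<lambda>x. of_real (x $ i) :: complex) differentiable (at x)"
    by (intro bounded_linear_imp_differentiable bounded_linear_compose[OF bounded_linear_of_real]
        bounded_linear_vec_nth)
  then show ?case using coord by (intro differentiable_mult) auto
next
  case (modulate f v)
  have "(\<lambda>x. exp (\<i> * of_real (x \<bullet> v))) differentiable (at x)"
    using differentiable_def has_derivative_iexp_inner by blast
  then show ?case using modulate by (intro differentiable_mult) auto
qed (auto simp: schwartz_differentiable)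

lemma schwartz_closure_partials:
  "f \<in> schwartz_closure \<Longrightarrow> partials [j] f \<in> schwartz_closure"
proof (induction rule: schwartz_closure.induct)
  case (base \<phi>)
  then show ?case by (intro schwartz_closure.base schwartz_partials)
next
  case (add f g)
  have "partials [j] (\<lambda>x. f x + g x) = (\<lambda>x. partials [j] f x + partials [j] g x)"
    using add.hyps
    by (subst partials_singleton_eqI[OF has_derivative_add[OF partials_has_derivative partials_has_derivative]])
      (auto simp: schwartz_closure_differentiable sum_of_real_axis)
  then show ?case
    using add.IH by (simp only:) (rule schwartz_closure.add)
next
  case (const f c)
  have "partials [j] (\<lambda>x. c * f x) = (\<lambda>x. c * partials [j] f x)"
    using const.hyps
    by (subst partials_singleton_eqI[OF has_derivative_mult_right[OF partials_has_derivative]])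
      (auto simp: schwartz_closure_differentiable sum_of_real_axis)
  then show ?case
    using const.IH by (simp only:) (rule schwartz_closure.const)
next
  case (coord f i)
  have D: "((\<lambda>x. of_real (x $ i) :: complex) has_derivative (\<lambda>h. of_real (h $ i))) (at x)" for x :: "real ^ 'a"
    by (intro bounded_linear_imp_has_derivative bounded_linear_compose[OF bounded_linear_of_real]
        bounded_linear_vec_nth)
  have ax: "axis j (1 :: real) $ i = (if i = j then 1 else 0)"
    by (simp add: axis_def)
  have "partials [j] (\<lambda>x. of_real (x $ i) * f x) =
      (\<lambda>x. of_real (x $ i) * partials [j] f x + (if i = j then 1 else 0) * f x)"
    using coord.hyps
    by (subst partials_singleton_eqI[OF has_derivative_mult[OF D partials_has_derivative]])
      (auto simp: schwartz_closure_differentiable sum_of_real_axis fun_eq_iff ax)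
  then show ?case
    using coord.IH coord.hyps
    by (simp only:) (intro schwartz_closure.add schwartz_closure.const schwartz_closure.coord)
next
  case (modulate f v)
  show ?case
    unfolding partials_modulate[OF schwartz_closure_differentiable[OF modulate.hyps]]
    using modulate.IH modulate.hyps
    by (intro schwartz_closure.add schwartz_closure.const schwartz_closure.modulate)
qed

lemma schwartz_closure_bounded:
  "f \<in> schwartz_closure \<Longrightarrow> \<exists>B. \<forall>x. (1 + norm x) ^ k * norm (f x) \<le> B"
proof (induction arbitrary: k rule: schwartz_closure.induct)
  case (base \<phi>)
  then show ?case using schwartz_bounded bounded_range_weight_iff by blast
next
  case (add f g)
  obtain B C where "\<And>x. (1 + norm x) ^ k * norm (f x) \<le> B" "\<And>x. (1 + norm x) ^ k * norm (g x) \<le> C"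
    using add.IH by meson
  then have "(1 + norm x) ^ k * norm (f x + g x) \<le> B + C" for x
    using mult_left_mono[OF norm_triangle_ineq[of "f x" "g x"], of "(1 + norm x) ^ k"]
      add_mono[of "(1 + norm x) ^ k * norm (f x)" B "(1 + norm x) ^ k * norm (g x)" C]
    by (simp add: distrib_left)
  then show ?case by blast
next
  case (const f c)
  obtain B where B: "\<And>x. (1 + norm x) ^ k * norm (f x) \<le> B"
    using const.IH by meson
  have "(1 + norm x) ^ k * norm (c * f x) \<le> norm c * B" for x
    using mult_left_mono[OF B[of x], of "norm c"] by (simp add: norm_mult mult_ac)
  then show ?case by blast
next
  case (coord f i)
  \<comment> \<open>A coordinate factor costs one power of the weight, available because the
    induction hypothesis covers every exponent.\<close>
  obtain B where B: "\<And>x. (1 + norm x) ^ Suc k * norm (f x) \<le> B"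
    using coord.IH by meson
  have "(1 + norm x) ^ k * norm (of_real (x $ i) * f x) \<le> B" for x
  proof -
    have "\<bar>x $ i\<bar> \<le> 1 + norm x"
      using component_le_norm_cart[of x i] by simp
    then have "(1 + norm x) ^ k * norm (f x) * \<bar>x $ i\<bar> \<le> (1 + norm x) ^ k * norm (f x) * (1 + norm x)"
      by (intro mult_left_mono) auto
    also have "\<dots> = (1 + norm x) ^ Suc k * norm (f x)"
      by simp
    finally show ?thesis using B[of x] by (simp add: norm_mult mult_ac)
  qed
  then show ?case by blast
next
  case (modulate f v)
  then show ?case by (simp add: norm_mult)
qed

lemma schwartz_closure_eq: "schwartz_closure = schwartz"
proof
  show "schwartz_closure \<subseteq> schwartz"
    by (auto intro!: schwartz_coinduct[of _ schwartz_closure] schwartz_closure_differentiable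
        schwartz_closure_partials simp: bounded_range_weight_iff schwartz_closure_bounded
        simp del: partials.simps)
qed (auto intro: schwartz_closure.base)

lemmas schwartz_const_mult = schwartz_closure.const[unfolded schwartz_closure_eq]
  and schwartz_coord_mult = schwartz_closure.coord[unfolded schwartz_closure_eq]
  and schwartz_modulate = schwartz_closure.modulate[unfolded schwartz_closure_eq]

section \<open>Schwartz seminorms\<close>

lemma bdd_above_schwartz_norm:
  assumes "\<phi> \<in> schwartz"
  shows "bdd_above ((\<lambda>(js, x). (1 + norm x) ^ N * norm (partials js \<phi> x)) ` ({js. length js \<le> N} \<times> UNIV))"
proof -
  have "finite {js :: 'a list. length js \<le> N}"
    using finite_lists_length_le[of "UNIV :: 'a set" N] by simp
  moreover have "bdd_above (range (\<lambda>x. (1 + norm x) ^ N * norm (partials js \<phi> x)))" for js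
    by (intro bounded_imp_bdd_above schwartz_bounded schwartz_partials assms)
  ultimately have "bdd_above (\<Union>js\<in>{js :: 'a list. length js \<le> N}.
      range (\<lambda>x. (1 + norm x) ^ N * norm (partials js \<phi> x)))"
    by (simp add: bdd_above_UN)
  then show ?thesis
    by (rule bdd_above_mono) auto
qed

lemma schwartz_norm_bound:
  assumes "\<phi> \<in> schwartz" "length js \<le> N"
  shows "(1 + norm x) ^ N * norm (partials js \<phi> x) \<le> schwartz_norm N \<phi>"
  unfolding schwartz_norm_def
  using cSUP_upper[OF _ bdd_above_schwartz_norm[OF assms(1)], of "(js, x)"] assms(2) by simp

lemma schwartz_norm_least:
  assumes "\<And>js x. length js \<le> N \<Longrightarrow> (1 + norm x) ^ N * norm (partials js \<phi> x) \<le> B"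
  shows "schwartz_norm N \<phi> \<le> B"
  unfolding schwartz_norm_def
  by (rule cSUP_least) (auto simp: assms intro: exI[of _ "[]"])

lemma schwartz_norm_nonneg: "\<phi> \<in> schwartz \<Longrightarrow> 0 \<le> schwartz_norm N \<phi>"
  using order_trans[OF norm_ge_zero schwartz_norm_bound[of \<phi> "[]" N 0, simplified]] by simp

lemma schwartz_norm_partial:
  assumes "\<phi> \<in> schwartz"
  shows "schwartz_norm N (partials [j] \<phi>) \<le> schwartz_norm (Suc N) \<phi>"
proof (rule schwartz_norm_least)
  fix js :: "'a list" and x :: "real ^ 'a"
  assume "length js \<le> N"
  then have "(1 + norm x) ^ Suc N * norm (partials (js @ [j]) \<phi> x) \<le> schwartz_norm (Suc N) \<phi>"
    by (intro schwartz_norm_bound assms) auto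
  moreover have "(1 + norm x) ^ N \<le> (1 + norm x) ^ Suc N"
    by (intro power_increasing) auto
  ultimately show "(1 + norm x) ^ N * norm (partials js (partials [j] \<phi>) x) \<le> schwartz_norm (Suc N) \<phi>"
    unfolding partials_append by (meson mult_right_mono norm_ge_zero order_trans)
qed

lemma schwartz_norm_Suc:
  assumes "\<phi> \<in> schwartz"
  shows "schwartz_norm N \<phi> \<le> schwartz_norm (Suc N) \<phi>"
proof (rule schwartz_norm_least)
  fix js :: "'a list" and x :: "real ^ 'a"
  assume "length js \<le> N"
  then have "(1 + norm x) ^ Suc N * norm (partials js \<phi> x) \<le> schwartz_norm (Suc N) \<phi>"
    by (intro schwartz_norm_bound assms) auto
  moreover have "(1 + norm x) ^ N \<le> (1 + norm x) ^ Suc N"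
    by (intro power_increasing) auto
  ultimately show "(1 + norm x) ^ N * norm (partials js \<phi> x) \<le> schwartz_norm (Suc N) \<phi>"
    by (meson mult_right_mono norm_ge_zero order_trans)
qed

section \<open>The Fourier transform on the Schwartz space\<close>

lemma integrable_inverse_1_plus_square_lborel: "integrable lborel (\<lambda>x::real. inverse (1 + x\<^sup>2))"
  using integrable_inverse_1_plus_square
  by (simp add: set_integrable_def einterval_eq_UNIV)

text \<open>Each of the n coordinates satisfies 1 + x_b^2 \<le> (1 + |x|)^2, so the exponent 2n
  bounds the weight by a product of one-dimensional functions 1 / (1 + t^2), whose integrals are
  finite.\<close>

lemma integrable_norm_weight:
  "integrable lborel (\<lambda>x :: real ^ 'n::finite. 1 / (1 + norm x) ^ (2 * CARD('n)))"
proof (rule integrableI_bounded)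
  have le: "1 / (1 + norm x) ^ (2 * CARD('n)) \<le> (\<Prod>b\<in>Basis. inverse (1 + (x \<bullet> b)\<^sup>2))" for x :: "real ^ 'n"
  proof -
    have "1 + (x \<bullet> b)\<^sup>2 \<le> (1 + norm x)\<^sup>2" if "b \<in> Basis" for b
    proof -
      have "(x \<bullet> b)\<^sup>2 \<le> (norm x)\<^sup>2"
        using Basis_le_norm[OF that, of x] by (metis abs_ge_zero power2_abs power_mono)
      then show ?thesis
        unfolding power2_sum using norm_ge_zero[of x] by (simp add: add_increasing2)
    qed
    then have "(\<Prod>b\<in>Basis. 1 + (x \<bullet> b)\<^sup>2) \<le> (\<Prod>b\<in>(Basis :: (real ^ 'n) set). (1 + norm x)\<^sup>2)"
      by (intro prod_mono) (auto simp: add_nonneg_nonneg)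
    also have "\<dots> = (1 + norm x) ^ (2 * CARD('n))"
      by (simp add: power_mult)
    finally have "inverse ((1 + norm x) ^ (2 * CARD('n))) \<le> inverse (\<Prod>b\<in>Basis. 1 + (x \<bullet> b)\<^sup>2)"
      by (intro le_imp_inverse_le prod_pos) (auto simp: add_pos_nonneg)
    then show ?thesis by (simp add: inverse_eq_divide prod_dividef)
  qed
  have "(\<integral>\<^sup>+x. ennreal (norm (1 / (1 + norm (x :: real ^ 'n)) ^ (2 * CARD('n)))) \<partial>lborel)
      \<le> (\<integral>\<^sup>+(x::real ^ 'n). (\<Prod>b\<in>Basis. ennreal (inverse (1 + (x \<bullet> b)\<^sup>2))) \<partial>lborel)"
    using le by (intro nn_integral_mono) (auto simp: prod_ennreal intro!: ennreal_leI)
  also have "\<dots> = (\<Prod>b\<in>(Basis :: (real ^ 'n) set). (\<integral>\<^sup>+x. ennreal (inverse (1 + x\<^sup>2)) \<partial>lborel))"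
    by (subst nn_integral_lborel_prod) auto
  also have "\<dots> < \<infinity>"
    using integrable_inverse_1_plus_square_lborel
    by (simp add: integrable_iff_bounded less_top[symmetric] power_eq_top_ennreal)
  finally show "(\<integral>\<^sup>+x. ennreal (norm (1 / (1 + norm (x :: real ^ 'n)) ^ (2 * CARD('n)))) \<partial>lborel) < \<infinity>" .
qed measurable

text \<open>The constant comparing the L1 norm with a Schwartz seminorm; the type argument records
  the dimension.\<close>

definition weight_mass :: "'n::finite itself \<Rightarrow> real" where
  "weight_mass _ = (\<integral>(x :: real ^ 'n). 1 / (1 + norm x) ^ (2 * CARD('n)) \<partial>lborel)"

lemma weight_mass_nonneg: "0 \<le> weight_mass TYPE('n::finite)"
  unfolding weight_mass_def by (intro Bochner_Integration.integral_nonneg) auto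

lemma norm_weight_pos: "0 < (1 + norm x) ^ k"
  by (intro zero_less_power) (simp add: add_pos_nonneg)

lemma schwartz_le_weight:
  assumes "\<phi> \<in> schwartz"
  shows "norm (\<phi> x) \<le> schwartz_norm N \<phi> * (1 / (1 + norm x) ^ N)"
  using schwartz_norm_bound[OF assms, of "[]" N x] norm_weight_pos[of x N]
  by (simp add: field_simps)

text \<open>Of 2n + k powers of decay, k absorb the moment and 2n remain for integrability.\<close>

lemma schwartz_integrable_moment:
  fixes \<phi> :: "real ^ 'n::finite \<Rightarrow> complex"
  assumes "\<phi> \<in> schwartz"
  shows "integrable lborel (\<lambda>x. norm x ^ k * norm (\<phi> x))"
proof (rule Bochner_Integration.integrable_bound)
  show "integrable lborel (\<lambda>x :: real ^ 'n. schwartz_norm (2 * CARD('n) + k) \<phi> * (1 / (1 + norm x) ^ (2 * CARD('n))))"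
    using integrable_norm_weight by (rule integrable_mult_right)
  have "norm x ^ k * norm (\<phi> x) \<le> schwartz_norm (2 * CARD('n) + k) \<phi> * (1 / (1 + norm x) ^ (2 * CARD('n)))" for x
  proof -
    have "norm x ^ k * norm (\<phi> x) \<le> (1 + norm x) ^ k * (schwartz_norm (2 * CARD('n) + k) \<phi> * (1 / (1 + norm x) ^ (2 * CARD('n) + k)))"
      by (intro mult_mono schwartz_le_weight assms power_mono) auto
    also have "\<dots> = schwartz_norm (2 * CARD('n) + k) \<phi> * (1 / (1 + norm x) ^ (2 * CARD('n)))"
      using norm_weight_pos[of x k] by (simp add: power_add)
    finally show ?thesis .
  qed
  moreover have "0 \<le> schwartz_norm (2 * CARD('n) + k) \<phi> * (1 / (1 + norm x) ^ (2 * CARD('n)))" for x :: "real ^ 'n"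
    using schwartz_norm_nonneg[OF assms] by simp
  ultimately show "AE x in lborel. norm (norm x ^ k * norm (\<phi> x))
      \<le> norm (schwartz_norm (2 * CARD('n) + k) \<phi> * (1 / (1 + norm x) ^ (2 * CARD('n))))"
    by (intro AE_I2) (simp only: real_norm_def abs_of_nonneg norm_ge_zero zero_le_power mult_nonneg_nonneg)
  show "(\<lambda>x. norm x ^ k * norm (\<phi> x)) \<in> borel_measurable lborel"
    using schwartz_measurable[OF assms] by simp
qed

lemma schwartz_integrable: "\<phi> \<in> schwartz \<Longrightarrow> integrable lborel \<phi>"
  using schwartz_integrable_moment[of \<phi> 0] schwartz_measurable[of \<phi>]
  by (simp add: integrable_norm_iff)

lemma integral_norm_schwartz_le:
  fixes \<phi> :: "real ^ 'n::finite \<Rightarrow> complex"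
  assumes "\<phi> \<in> schwartz"
  shows "(\<integral>x. norm (\<phi> x) \<partial>lborel) \<le> weight_mass TYPE('n) * schwartz_norm (2 * CARD('n)) \<phi>"
proof -
  have "(\<integral>x. norm (\<phi> x) \<partial>lborel) \<le> (\<integral>(x :: real ^ 'n). schwartz_norm (2 * CARD('n)) \<phi> * (1 / (1 + norm x) ^ (2 * CARD('n))) \<partial>lborel)"
    using schwartz_integrable[OF assms] integrable_norm_weight schwartz_le_weight[OF assms]
    by (intro integral_mono) (auto intro!: integrable_mult_right integrable_norm simp del: times_divide_eq_right)
  also have "\<dots> = schwartz_norm (2 * CARD('n)) \<phi> * weight_mass TYPE('n)"
    unfolding weight_mass_def by (rule integral_mult_right_zero)
  finally show ?thesis by (simp add: mult.commute)
qed

section \<open>Affine substitutions and integrals of partial derivatives\<close>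

lemma
  fixes f :: "'a::euclidean_space \<Rightarrow> 'b::{banach, second_countable_topology}"
  assumes "c \<noteq> 0" and [measurable]: "f \<in> borel_measurable borel"
  shows integral_lborel_affine: "(\<integral>x. f x \<partial>lborel) = \<bar>c\<bar> ^ DIM('a) *\<^sub>R (\<integral>x. f (t + c *\<^sub>R x) \<partial>lborel)"
    and integrable_lborel_affine_iff: "integrable lborel (\<lambda>x. f (t + c *\<^sub>R x)) \<longleftrightarrow> integrable lborel f"
proof -
  show "(\<integral>x. f x \<partial>lborel) = \<bar>c\<bar> ^ DIM('a) *\<^sub>R (\<integral>x. f (t + c *\<^sub>R x) \<partial>lborel)"
    by (subst lborel_affine[OF assms(1), of t])
      (simp add: ennreal_power integral_density integral_distr)
  have 1: "integrable lborel (\<lambda>x. f (t + c *\<^sub>R x))"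
    if "integrable lborel (\<lambda>x. \<bar>c\<bar> ^ DIM('a) *\<^sub>R f (t + c *\<^sub>R x))"
    using integrable_scaleR_right[OF that, of "inverse (\<bar>c\<bar> ^ DIM('a))"] assms(1) by simp
  have "integrable lborel f \<longleftrightarrow> integrable (density (distr lborel borel (\<lambda>x. t + c *\<^sub>R x)) (\<lambda>_. ennreal (\<bar>c\<bar> ^ DIM('a)))) f"
    by (subst lborel_affine[OF assms(1), of t]) (simp add: ennreal_power)
  also have "\<dots> \<longleftrightarrow> integrable lborel (\<lambda>x. \<bar>c\<bar> ^ DIM('a) *\<^sub>R f (t + c *\<^sub>R x))"
    by (simp add: integrable_density integrable_distr_eq)
  also have "\<dots> \<longleftrightarrow> integrable lborel (\<lambda>x. f (t + c *\<^sub>R x))"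
    by (rule iffI[OF 1]) (simp_all add: integrable_scaleR_right)
  finally show "integrable lborel (\<lambda>x. f (t + c *\<^sub>R x)) \<longleftrightarrow> integrable lborel f" ..
qed

lemma has_vector_derivative_tendsto_quotient:
  assumes "(f has_vector_derivative D) (at a)"
  shows "((\<lambda>t. (f t - f a) /\<^sub>R (t - a)) \<longlongrightarrow> D) (at a)"
proof -
  have "((\<lambda>t. norm (f t - f a - (t - a) *\<^sub>R D) / norm (t - a)) \<longlongrightarrow> 0) (at a)"
    using assms by (simp add: has_vector_derivative_def has_derivative_iff_norm)
  then have "((\<lambda>t. norm ((f t - f a) /\<^sub>R (t - a) - D)) \<longlongrightarrow> 0) (at a)"
  proof (rule Lim_transform_eventually)
    show "\<forall>\<^sub>F t in at a. norm (f t - f a - (t - a) *\<^sub>R D) / norm (t - a) = norm ((f t - f a) /\<^sub>R (t - a) - D)"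
    proof (rule eventually_mono[OF eventually_neq_at_within[of a]])
      fix t assume "t \<noteq> a"
      then have "(f t - f a) /\<^sub>R (t - a) - D = (f t - f a - (t - a) *\<^sub>R D) /\<^sub>R (t - a)"
        by (simp add: scaleR_diff_right)
      then show "norm (f t - f a - (t - a) *\<^sub>R D) / norm (t - a) = norm ((f t - f a) /\<^sub>R (t - a) - D)"
        by (simp add: divide_inverse mult.commute)
    qed
  qed
  then show ?thesis
    by (rule LIM_zero_cancel[OF tendsto_norm_zero_cancel])
qed

lemma schwartz_directional:
  assumes "\<phi> \<in> schwartz"
  shows "((\<lambda>t. \<phi> (x + t *\<^sub>R axis j 1)) has_vector_derivative partials [j] \<phi> (x + t *\<^sub>R axis j 1)) (at t within S)"
proof -
  have "((\<lambda>t. x + t *\<^sub>R axis j 1) has_derivative (\<lambda>d. d *\<^sub>R axis j 1)) (at t within S)"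
    by (auto intro!: derivative_eq_intros)
  from has_derivative_compose[OF this partials_has_derivative[OF schwartz_differentiable[OF assms]]]
  have "((\<lambda>t. \<phi> (x + t *\<^sub>R axis j 1)) has_derivative
      (\<lambda>d. \<Sum>i\<in>UNIV. of_real ((d *\<^sub>R axis j 1) $ i) * partials [i] \<phi> (x + t *\<^sub>R axis j 1))) (at t within S)" .
  moreover have "(\<Sum>i\<in>UNIV. of_real ((d *\<^sub>R axis j 1) $ i) * partials [i] \<phi> y) = d *\<^sub>R partials [j] \<phi> y" for d y
    unfolding vector_scaleR_component real_scaleR_def of_real_mult mult.assoc
      sum_distrib_left[symmetric] sum_of_real_axis by (simp add: scaleR_conv_of_real)
  ultimately show ?thesis
    by (simp add: has_vector_derivative_def)
qed

text \<open>The integral of a partial derivative vanishes because the integrals of the difference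
  quotients do, by translation invariance.\<close>

lemma schwartz_integral_partial:
  fixes \<phi> :: "real ^ 'n::finite \<Rightarrow> complex"
  assumes "\<phi> \<in> schwartz"
  shows "(\<integral>x. partials [j] \<phi> x \<partial>lborel) = 0"
proof -
  \<comment> \<open>A sequence, as dominated convergence requires; steps of length at most 1 keep
    the shifted point within unit distance.\<close>
  define h where "h k = inverse (real (Suc k))" for k
  have h: "0 < h k" "h k \<le> 1" for k
    by (auto simp: h_def inverse_le_1_iff)
  define q where "q k x = (\<phi> (x + h k *\<^sub>R axis j 1) - \<phi> x) /\<^sub>R h k" for k x
  define K where "K = 2 * CARD('n)"
  define M where "M = schwartz_norm K (partials [j] \<phi>)"
  have P: "partials [j] \<phi> \<in> schwartz"
    using assms by (rule schwartz_partials)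
  have M: "0 \<le> M"
    unfolding M_def by (rule schwartz_norm_nonneg[OF P])
  have [measurable]: "\<phi> \<in> borel_measurable borel" "partials [j] \<phi> \<in> borel_measurable borel"
    using assms P by (auto dest: schwartz_measurable)
  have "(\<lambda>k. \<integral>x. q k x \<partial>lborel) \<longlonglongrightarrow> (\<integral>x. partials [j] \<phi> x \<partial>lborel)"
  proof (rule integral_dominated_convergence)
    show "integrable lborel (\<lambda>x :: real ^ 'n. M * 2 ^ K * (1 / (1 + norm x) ^ K))"
      unfolding K_def by (rule integrable_mult_right[OF integrable_norm_weight])
    show "AE x in lborel. (\<lambda>k. q k x) \<longlonglongrightarrow> partials [j] \<phi> x"
    proof (rule AE_I2)
      fix x
      have "((\<lambda>t. \<phi> (x + t *\<^sub>R axis j 1)) has_vector_derivative partials [j] \<phi> x) (at 0)"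
        using schwartz_directional[OF assms, of x j 0] by simp
      then have "((\<lambda>t. (\<phi> (x + t *\<^sub>R axis j 1) - \<phi> x) /\<^sub>R t) \<longlongrightarrow> partials [j] \<phi> x) (at 0)"
        using has_vector_derivative_tendsto_quotient[of "\<lambda>t. \<phi> (x + t *\<^sub>R axis j 1)" "partials [j] \<phi> x" 0]
        by (simp only: diff_zero scale_zero_left add_0_right)
      moreover have "filterlim h (at 0) sequentially"
        using h LIMSEQ_inverse_real_of_nat by (auto simp: filterlim_at h_def[abs_def])
      ultimately show "(\<lambda>k. q k x) \<longlonglongrightarrow> partials [j] \<phi> x"
        unfolding q_def by (rule filterlim_compose)
    qed
    show "AE x in lborel. norm (q k x) \<le> M * 2 ^ K * (1 / (1 + norm x) ^ K)" for k
    proof (rule AE_I2)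
      fix x :: "real ^ 'n"
      \<comment> \<open>Moving by at most 1 changes 1 + |x| by at most a factor 2, whence
        \<open>2 ^ K\<close>. The mean value inequality then yields a majorant of the difference
        quotients that does not depend on \<open>k\<close>.\<close>
      have le: "norm (partials [j] \<phi> (x + t *\<^sub>R axis j 1)) \<le> M * 2 ^ K * (1 / (1 + norm x) ^ K)"
        if "t \<in> {0..h k}" for t
      proof -
        define y where "y = x + t *\<^sub>R axis j 1"
        have "norm (t *\<^sub>R axis j (1::real)) \<le> 1"
          using that h[of k] by simp
        then have "norm x \<le> norm y + 1"
          using norm_triangle_ineq4[of y "t *\<^sub>R axis j 1"] by (simp add: y_def)
        then have "1 + norm x \<le> 2 * (1 + norm y)"
          using add_mono[OF _ norm_ge_zero[of y], of "norm x" "norm y + 1"] by simp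
        then have "(1 + norm x) ^ K \<le> (2 * (1 + norm y)) ^ K"
          by (intro power_mono) auto
        then have "(1 + norm x) ^ K \<le> 2 ^ K * (1 + norm y) ^ K"
          by (simp only: power_mult_distrib)
        then have "1 / (1 + norm y) ^ K \<le> 2 ^ K * (1 / (1 + norm x) ^ K)"
          using norm_weight_pos[of x K] norm_weight_pos[of y K]
          by (simp add: field_simps)
        then have "M * (1 / (1 + norm y) ^ K) \<le> M * (2 ^ K * (1 / (1 + norm x) ^ K))"
          using M by (rule mult_left_mono)
        then show ?thesis
          using schwartz_le_weight[OF P, of y K] by (simp add: y_def M_def mult_ac)
      qed
      have "norm (\<phi> (x + h k *\<^sub>R axis j 1) - \<phi> (x + 0 *\<^sub>R axis j 1)) \<le>
          (M * 2 ^ K * (1 / (1 + norm x) ^ K)) * norm (h k - 0)"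
      proof (rule differentiable_bound[of "{0..h k}" "\<lambda>t. \<phi> (x + t *\<^sub>R axis j 1)"
            "\<lambda>t d. d *\<^sub>R partials [j] \<phi> (x + t *\<^sub>R axis j 1)"])
        fix t assume t: "t \<in> {0..h k}"
        show "((\<lambda>t. \<phi> (x + t *\<^sub>R axis j 1)) has_derivative (\<lambda>d. d *\<^sub>R partials [j] \<phi> (x + t *\<^sub>R axis j 1))) (at t within {0..h k})"
          using schwartz_directional[OF assms] by (simp add: has_vector_derivative_def)
        show "onorm (\<lambda>d. d *\<^sub>R partials [j] \<phi> (x + t *\<^sub>R axis j 1)) \<le> M * 2 ^ K * (1 / (1 + norm x) ^ K)"
          using mult_right_mono[OF le[OF t] abs_ge_zero] by (intro onorm_le) (simp add: mult.commute)
      qed (use h[of k] in auto)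
      then show "norm (q k x) \<le> M * 2 ^ K * (1 / (1 + norm x) ^ K)"
        using h[of k] by (simp add: q_def divide_inverse[symmetric] pos_divide_le_eq inverse_eq_divide)
    qed
  qed (simp_all add: q_def[abs_def])
  moreover have "(\<integral>x. q k x \<partial>lborel) = 0" for k
  proof -
    have "integrable lborel (\<lambda>x. \<phi> (x + h k *\<^sub>R axis j 1))"
      using integrable_lborel_affine_iff[of 1 \<phi> "h k *\<^sub>R axis j 1"] schwartz_integrable[OF assms]
      by (simp add: add.commute)
    moreover have "(\<integral>x. \<phi> (x + h k *\<^sub>R axis j 1) \<partial>lborel) = (\<integral>x. \<phi> x \<partial>lborel)"
      using integral_lborel_affine[of 1 \<phi> "h k *\<^sub>R axis j 1"] by (simp add: add.commute)
    ultimately show ?thesis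
      using schwartz_integrable[OF assms] by (simp add: q_def)
  qed
  ultimately show ?thesis
    by (simp add: LIMSEQ_const_iff)
qed

text \<open>The sign treats both transforms at once: \<open>s = - 1\<close> is
  \<open>fourier\<close>, and \<open>s = 1\<close> is \<open>inv_fourier\<close> up to its
  normalising constant. The exponential stands first so that the integrand is literally a modulated
  Schwartz function.\<close>

definition signed_fourier :: "real \<Rightarrow> (real ^ 'n \<Rightarrow> complex) \<Rightarrow> real ^ 'n::finite \<Rightarrow> complex" where
  "signed_fourier s \<phi> \<xi> = (\<integral>x. exp (\<i> * of_real (x \<bullet> (s *\<^sub>R \<xi>))) * \<phi> x \<partial>lborel)"

lemma signed_fourier_integrable:
  "\<phi> \<in> schwartz \<Longrightarrow> integrable lborel (\<lambda>x. exp (\<i> * of_real (x \<bullet> v)) * \<phi> x)"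
  by (intro schwartz_integrable schwartz_modulate)

lemma norm_signed_fourier_le:
  fixes \<phi> :: "real ^ 'n::finite \<Rightarrow> complex"
  assumes "\<phi> \<in> schwartz"
  shows "norm (signed_fourier s \<phi> \<xi>) \<le> weight_mass TYPE('n) * schwartz_norm (2 * CARD('n)) \<phi>"
proof -
  have "norm (signed_fourier s \<phi> \<xi>) \<le> (\<integral>x. norm (exp (\<i> * of_real (x \<bullet> (s *\<^sub>R \<xi>))) * \<phi> x) \<partial>lborel)"
    unfolding signed_fourier_def by (rule integral_norm_bound)
  also have "\<dots> = (\<integral>x. norm (\<phi> x) \<partial>lborel)"
    by (simp add: norm_mult)
  finally show ?thesis using integral_norm_schwartz_le[OF assms] by linarith
qed

lemma signed_fourier_const_mult: "signed_fourier s (\<lambda>x. c * \<phi> x) \<xi> = c * signed_fourier s \<phi> \<xi>"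
  by (simp add: signed_fourier_def mult.left_commute)

lemma signed_fourier_add:
  "\<phi> \<in> schwartz \<Longrightarrow> \<psi> \<in> schwartz \<Longrightarrow>
    signed_fourier s (\<lambda>x. \<phi> x + \<psi> x) \<xi> = signed_fourier s \<phi> \<xi> + signed_fourier s \<psi> \<xi>"
  unfolding signed_fourier_def distrib_left
  by (intro Bochner_Integration.integral_add signed_fourier_integrable)

text \<open>Integration by parts: the partial derivative of the modulated function has integral 0,
  and the product rule splits that integral into the two terms.\<close>

lemma signed_fourier_partial:
  assumes "\<phi> \<in> schwartz"
  shows "signed_fourier s (partials [j] \<phi>) \<xi> = - (\<i> * of_real (s * \<xi> $ j)) * signed_fourier s \<phi> \<xi>"
proof -
  let ?e = "\<lambda>x. exp (\<i> * of_real (x \<bullet> (s *\<^sub>R \<xi>)))"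
  have "(\<integral>x. partials [j] (\<lambda>x. ?e x * \<phi> x) x \<partial>lborel) = 0"
    by (intro schwartz_integral_partial schwartz_modulate assms)
  then have "(\<integral>x. ?e x * partials [j] \<phi> x + (\<i> * of_real ((s *\<^sub>R \<xi>) $ j)) * (?e x * \<phi> x) \<partial>lborel) = 0"
    by (simp only: partials_modulate[OF schwartz_differentiable[OF assms]])
  then have "signed_fourier s (partials [j] \<phi>) \<xi> + \<i> * of_real (s * \<xi> $ j) * signed_fourier s \<phi> \<xi> = 0"
    unfolding signed_fourier_def
    using Bochner_Integration.integral_add[OF signed_fourier_integrable[OF schwartz_partials[OF assms, of "[j]"]]
        integrable_mult_right[OF signed_fourier_integrable[OF assms]], of "s *\<^sub>R \<xi>" "\<i> * of_real ((s *\<^sub>R \<xi>) $ j)" "s *\<^sub>R \<xi>"]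
    by (simp del: inner_scaleR_right)
  then show ?thesis
    by (simp add: add_eq_0_iff)
qed

text \<open>The remainder is estimated directly by |exp (i u) - 1 - i u| \<le> u^2 / 2 with u = s (x
  \<bullet> h). The finite second moment of \<phi> then gives a bound quadratic in
  \<open>h\<close>.\<close>

lemma signed_fourier_has_derivative:
  fixes \<phi> :: "real ^ 'n::finite \<Rightarrow> complex"
  assumes "\<phi> \<in> schwartz"
  shows "(signed_fourier s \<phi> has_derivative
    (\<lambda>h. \<Sum>j\<in>UNIV. of_real (h $ j) * signed_fourier s (\<lambda>x. \<i> * of_real s * (of_real (x $ j) * \<phi> x)) \<xi>)) (at \<xi>)"
    (is "(_ has_derivative ?D) _")
proof -
  let ?e = "\<lambda>\<xi> x. exp (\<i> * of_real (x \<bullet> (s *\<^sub>R \<xi>)))"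
  define C where "C = s\<^sup>2 * (\<integral>x. (norm x)\<^sup>2 * norm (\<phi> x) \<partial>lborel)"
  have S: "(\<lambda>x. \<i> * of_real s * (of_real (x $ j) * \<phi> x)) \<in> schwartz" for j
    by (intro schwartz_const_mult schwartz_coord_mult assms)
  have "bounded_linear ?D"
    by (intro bounded_linear_sum bounded_linear_compose[OF bounded_linear_mult_left]
        bounded_linear_compose[OF bounded_linear_of_real] bounded_linear_vec_nth)
  moreover have bound: "norm (signed_fourier s \<phi> (\<xi> + h) - signed_fourier s \<phi> \<xi> - ?D h) \<le> C * (norm h)\<^sup>2" for h
  proof -
    have D: "?D h = (\<integral>x. (\<i> * of_real (s * (x \<bullet> h))) * (?e \<xi> x * \<phi> x) \<partial>lborel)"
    proof -
      have "?D h = (\<Sum>j\<in>UNIV. (\<integral>x. of_real (h $ j) * (?e \<xi> x * (\<i> * of_real s * (of_real (x $ j) * \<phi> x))) \<partial>lborel))"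
        by (simp only: signed_fourier_def integral_mult_right_zero)
      also have "\<dots> = (\<integral>x. (\<Sum>j\<in>UNIV. of_real (h $ j) * (?e \<xi> x * (\<i> * of_real s * (of_real (x $ j) * \<phi> x)))) \<partial>lborel)"
        by (intro Bochner_Integration.integral_sum[symmetric] integrable_mult_right signed_fourier_integrable S)
      also have "\<dots> = (\<integral>x. (\<i> * of_real (s * (x \<bullet> h))) * (?e \<xi> x * \<phi> x) \<partial>lborel)"
        by (intro Bochner_Integration.integral_cong refl)
          (simp add: inner_vec_def sum_distrib_left sum_distrib_right mult_ac)
      finally show ?thesis .
    qed
    have I: "integrable lborel (\<lambda>x. (\<i> * of_real (s * (x \<bullet> h))) * (?e \<xi> x * \<phi> x))"
    proof -
      have "integrable lborel (\<lambda>x. (\<Sum>j\<in>UNIV. of_real (h $ j) * (?e \<xi> x * (\<i> * of_real s * (of_real (x $ j) * \<phi> x)))))"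
        by (intro Bochner_Integration.integrable_sum integrable_mult_right signed_fourier_integrable S)
      then show ?thesis
        by (rule Bochner_Integration.integrable_cong[THEN iffD1, rotated 2])
          (simp_all add: inner_vec_def sum_distrib_left sum_distrib_right mult_ac)
    qed
    have "signed_fourier s \<phi> (\<xi> + h) - signed_fourier s \<phi> \<xi> - ?D h =
        (\<integral>x. ?e (\<xi> + h) x * \<phi> x - ?e \<xi> x * \<phi> x - (\<i> * of_real (s * (x \<bullet> h))) * (?e \<xi> x * \<phi> x) \<partial>lborel)"
      unfolding D
      unfolding signed_fourier_def
      by (simp only: Bochner_Integration.integral_diff Bochner_Integration.integrable_diff
          signed_fourier_integrable[OF assms] I)
    also have "norm \<dots> \<le> (\<integral>x. (s\<^sup>2 * (norm h)\<^sup>2) * ((norm x)\<^sup>2 * norm (\<phi> x)) \<partial>lborel)"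
    proof (rule Bochner_Integration.integral_norm_bound_integral)
      show "integrable lborel (\<lambda>x. ?e (\<xi> + h) x * \<phi> x - ?e \<xi> x * \<phi> x - (\<i> * of_real (s * (x \<bullet> h))) * (?e \<xi> x * \<phi> x))"
        by (intro Bochner_Integration.integrable_diff signed_fourier_integrable assms I)
      show "integrable lborel (\<lambda>x. (s\<^sup>2 * (norm h)\<^sup>2) * ((norm x)\<^sup>2 * norm (\<phi> x)))"
        by (intro integrable_mult_right schwartz_integrable_moment assms)
      fix x
      define u where "u = s * (x \<bullet> h)"
      have "norm (exp (\<i> * of_real u) - 1 - \<i> * of_real u) \<le> u\<^sup>2 / 2"
        using iexp_approx1[of u 1] by (simp add: diff_diff_eq numeral_2_eq_2)
      also have "\<dots> \<le> u\<^sup>2" by simp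
      also have "\<dots> \<le> s\<^sup>2 * (norm h)\<^sup>2 * (norm x)\<^sup>2"
      proof -
        have cs: "(x \<bullet> h)\<^sup>2 \<le> (norm h)\<^sup>2 * (norm x)\<^sup>2"
          using Cauchy_Schwarz_ineq[of x h] by (simp add: power2_norm_eq_inner mult.commute)
        show ?thesis
          unfolding u_def power_mult_distrib mult.assoc by (rule mult_left_mono[OF cs]) simp
      qed
      finally have u: "norm (exp (\<i> * of_real u) - 1 - \<i> * of_real u) \<le> s\<^sup>2 * (norm h)\<^sup>2 * (norm x)\<^sup>2" .
      have "?e (\<xi> + h) x = ?e \<xi> x * exp (\<i> * of_real u)"
        by (simp add: u_def exp_add[symmetric] algebra_simps inner_add_right)
      then have "?e (\<xi> + h) x * \<phi> x - ?e \<xi> x * \<phi> x - (\<i> * of_real (s * (x \<bullet> h))) * (?e \<xi> x * \<phi> x) =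
          ?e \<xi> x * ((exp (\<i> * of_real u) - 1 - \<i> * of_real u) * \<phi> x)"
        by (simp add: u_def algebra_simps)
      then show "norm (?e (\<xi> + h) x * \<phi> x - ?e \<xi> x * \<phi> x - (\<i> * of_real (s * (x \<bullet> h))) * (?e \<xi> x * \<phi> x))
          \<le> (s\<^sup>2 * (norm h)\<^sup>2) * ((norm x)\<^sup>2 * norm (\<phi> x))"
        using mult_right_mono[OF u norm_ge_zero[of "\<phi> x"]] by (simp add: norm_mult mult.assoc)
    qed
    also have "\<dots> = C * (norm h)\<^sup>2"
      by (simp add: C_def)
    finally show ?thesis .
  qed
  moreover have "((\<lambda>h. norm (signed_fourier s \<phi> (\<xi> + h) - signed_fourier s \<phi> \<xi> - ?D h) / norm h) \<longlongrightarrow> 0) (at 0)"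
  proof (rule Lim_null_comparison)
    show "\<forall>\<^sub>F h in at 0. norm (norm (signed_fourier s \<phi> (\<xi> + h) - signed_fourier s \<phi> \<xi> - ?D h) / norm h) \<le> C * norm h"
    proof (rule always_eventually, rule allI)
      fix h
      show "norm (norm (signed_fourier s \<phi> (\<xi> + h) - signed_fourier s \<phi> \<xi> - ?D h) / norm h) \<le> C * norm h"
        using divide_right_mono[OF bound[of h] norm_ge_zero[of h]]
        by (cases "h = 0") (simp_all add: power2_eq_square)
    qed
    have "((\<lambda>h::real ^ 'n. C * norm h) \<longlongrightarrow> C * norm (0::real ^ 'n)) (at 0)"
      by (intro tendsto_intros)
    then show "((\<lambda>h::real ^ 'n. C * norm h) \<longlongrightarrow> 0) (at 0)" by simp
  qed
  ultimately show ?thesis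
    by (simp add: has_derivative_at)
qed

text \<open>The factor 1 + |\<xi>| is at most 1 plus the sum of the |\<xi> j|, and multiplication by
  \<xi> j gives the transform of a partial derivative up to a factor of modulus 1. Each power thus
  turns one transform into n + 1 and uses one more derivative, which explains
  \<open>(1 + real CARD('n)) ^ k\<close> and the seminorm index.\<close>

lemma signed_fourier_weighted_le:
  fixes \<phi> :: "real ^ 'n::finite \<Rightarrow> complex"
  assumes "\<bar>s\<bar> = 1" "\<phi> \<in> schwartz"
  shows "(1 + norm \<xi>) ^ k * norm (signed_fourier s \<phi> \<xi>)
    \<le> weight_mass TYPE('n) * (1 + real CARD('n)) ^ k * schwartz_norm (2 * CARD('n) + k) \<phi>"
  using assms(2)
proof (induction k arbitrary: \<phi>)
  case 0
  then show ?case using norm_signed_fourier_le by simp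
next
  case (Suc k)
  let ?W = "weight_mass TYPE('n) * (1 + real CARD('n)) ^ k"
  let ?N = "2 * CARD('n) + k"
  have W: "0 \<le> ?W" using weight_mass_nonneg[where ?'n = 'n] by simp
  have "(1 + norm \<xi>) * norm (signed_fourier s \<phi> \<xi>) \<le>
      (1 + (\<Sum>j\<in>UNIV. \<bar>\<xi> $ j\<bar>)) * norm (signed_fourier s \<phi> \<xi>)"
    using norm_le_l1_cart[of \<xi>] by (intro mult_right_mono) auto
  also have "\<dots> = norm (signed_fourier s \<phi> \<xi>) + (\<Sum>j\<in>UNIV. norm (signed_fourier s (partials [j] \<phi>) \<xi>))"
    using assms(1) by (simp add: signed_fourier_partial[OF Suc.prems] norm_mult abs_mult distrib_right sum_distrib_right)
  finally have le: "(1 + norm \<xi>) * norm (signed_fourier s \<phi> \<xi>)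
      \<le> norm (signed_fourier s \<phi> \<xi>) + (\<Sum>j\<in>UNIV. norm (signed_fourier s (partials [j] \<phi>) \<xi>))" .
  have "(1 + norm \<xi>) ^ Suc k * norm (signed_fourier s \<phi> \<xi>) \<le>
      (1 + norm \<xi>) ^ k * (norm (signed_fourier s \<phi> \<xi>) + (\<Sum>j\<in>UNIV. norm (signed_fourier s (partials [j] \<phi>) \<xi>)))"
    unfolding power_Suc2 mult.assoc by (rule mult_left_mono[OF le]) simp
  also have "\<dots> = (1 + norm \<xi>) ^ k * norm (signed_fourier s \<phi> \<xi>) +
      (\<Sum>j\<in>UNIV. (1 + norm \<xi>) ^ k * norm (signed_fourier s (partials [j] \<phi>) \<xi>))"
    by (simp add: distrib_left sum_distrib_left)
  also have "\<dots> \<le> ?W * schwartz_norm ?N \<phi> + (\<Sum>j\<in>UNIV. ?W * schwartz_norm ?N (partials [j] \<phi>))"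
    by (intro add_mono sum_mono Suc.IH Suc.prems schwartz_partials)
  also have "\<dots> \<le> ?W * schwartz_norm (Suc ?N) \<phi> + (\<Sum>j\<in>(UNIV :: 'n set). ?W * schwartz_norm (Suc ?N) \<phi>)"
    by (intro add_mono sum_mono mult_left_mono[OF _ W] schwartz_norm_Suc schwartz_norm_partial Suc.prems)
  also have "\<dots> = weight_mass TYPE('n) * (1 + real CARD('n)) ^ Suc k * schwartz_norm (2 * CARD('n) + Suc k) \<phi>"
    by (simp add: algebra_simps)
  finally show ?case .
qed

text \<open>Coinduction on the set of all transforms: a partial derivative of a transform is the
  transform of a coordinate multiple, which is again Schwartz.\<close>

lemma signed_fourier_schwartz:
  fixes \<phi> :: "real ^ 'n::finite \<Rightarrow> complex"
  assumes "\<bar>s\<bar> = 1" "\<phi> \<in> schwartz"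
  shows "signed_fourier s \<phi> \<in> schwartz"
proof (rule schwartz_coinduct[of _ "signed_fourier s ` schwartz"])
  fix f assume "f \<in> signed_fourier s ` (schwartz :: (real ^ 'n \<Rightarrow> complex) set)"
  then obtain \<psi> where \<psi>: "\<psi> \<in> schwartz" "f = signed_fourier s \<psi>" by blast
  show "f differentiable (at x)" for x
    using signed_fourier_has_derivative[OF \<psi>(1)] \<psi>(2) differentiable_def by blast
  show "bounded (range (\<lambda>x. (1 + norm x) ^ k * norm (f x)))" for k
    using signed_fourier_weighted_le[OF assms(1) \<psi>(1)] \<psi>(2) bounded_range_weight_iff by blast
  show "partials [j] f \<in> signed_fourier s ` schwartz" for j
  proof -
    have "partials [j] f = signed_fourier s (\<lambda>x. \<i> * of_real s * (of_real (x $ j) * \<psi> x))"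
      unfolding \<psi>(2) partials_singleton_eqI[OF signed_fourier_has_derivative[OF \<psi>(1)]]
      by (simp add: sum_of_real_axis fun_eq_iff)
    then show ?thesis
      using schwartz_const_mult[OF schwartz_coord_mult[OF \<psi>(1)]] by blast
  qed
qed (use assms in blast)

section \<open>Fourier inversion\<close>

lemma
  fixes f :: "'a::euclidean_space \<Rightarrow> real \<Rightarrow> 'b::{real_normed_field, banach, second_countable_topology}"
  assumes f: "\<And>b. b \<in> Basis \<Longrightarrow> integrable lborel (f b)"
  shows integral_lborel_prod: "(\<integral>x. (\<Prod>b\<in>Basis. f b (x \<bullet> b)) \<partial>lborel) = (\<Prod>b\<in>Basis. \<integral>x. f b x \<partial>lborel)"
    and integrable_lborel_prod: "integrable lborel (\<lambda>x. \<Prod>b\<in>Basis. f b (x \<bullet> b))"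
proof -
  interpret product_sigma_finite "\<lambda>_ :: 'a. lborel :: real measure" by standard
  have m [measurable]: "b \<in> Basis \<Longrightarrow> f b \<in> borel_measurable borel" for b
    using f by (auto dest: borel_measurable_integrable)
  have P: "(\<Prod>b\<in>Basis. f b ((\<Sum>c\<in>Basis. x c *\<^sub>R c) \<bullet> b)) = (\<Prod>b\<in>Basis. f b (x b))" for x
    by (intro prod.cong refl) simp
  have T: "(\<lambda>x. \<Sum>b\<in>Basis. x b *\<^sub>R b) \<in> measurable (Pi\<^sub>M Basis (\<lambda>_. lborel)) (borel :: 'a measure)"
    by measurable
  show "(\<integral>x. (\<Prod>b\<in>Basis. f b (x \<bullet> b)) \<partial>lborel) = (\<Prod>b\<in>Basis. \<integral>x. f b x \<partial>lborel)"
    by (subst lborel_eq, subst integral_distr[OF T]) (simp_all add: P product_integral_prod f)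
  show "integrable lborel (\<lambda>x. \<Prod>b\<in>Basis. f b (x \<bullet> b))"
    by (subst lborel_eq, subst integrable_distr_eq[OF T]) (simp_all add: P product_integrable_prod f)
qed

text \<open>The characteristic function of the standard normal law, cleared of its normalising
  constant.\<close>

lemma
  shows integrable_iexp_gaussian_real: "integrable lborel (\<lambda>x. exp (\<i> * of_real (x * t)) * of_real (exp (- x\<^sup>2 / 2)))"
    and integral_iexp_gaussian_real: "(\<integral>x. exp (\<i> * of_real (x * t)) * of_real (exp (- x\<^sup>2 / 2)) \<partial>lborel) = of_real (sqrt (2 * pi) * exp (- t\<^sup>2 / 2))"
proof -
  have eq: "exp (\<i> * of_real (x * t)) * of_real (exp (- x\<^sup>2 / 2)) = of_real (sqrt (2 * pi)) * (std_normal_density x *\<^sub>R iexp (t * x))" for x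
    by (simp add: std_normal_density_def scaleR_conv_of_real mult_ac)
  have "integrable std_normal_distribution (\<lambda>x. iexp (t * x))"
    by (rule prob_space.integrable_iexp[OF real_distribution.axioms(1)[OF real_dist_normal_dist]]) (simp_all del: of_real_mult)
  then have "integrable lborel (\<lambda>x. std_normal_density x *\<^sub>R iexp (t * x))"
    by (subst (asm) integrable_density) auto
  then show "integrable lborel (\<lambda>x. exp (\<i> * of_real (x * t)) * of_real (exp (- x\<^sup>2 / 2)))"
    unfolding eq by (rule integrable_mult_right)
  have "(\<integral>x. std_normal_density x *\<^sub>R iexp (t * x) \<partial>lborel) = char std_normal_distribution t"
    unfolding char_def by (subst integral_density) auto
  then show "(\<integral>x. exp (\<i> * of_real (x * t)) * of_real (exp (- x\<^sup>2 / 2)) \<partial>lborel) = of_real (sqrt (2 * pi) * exp (- t\<^sup>2 / 2))"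
    unfolding eq by (subst integral_mult_right_zero) (simp add: char_std_normal_distribution)
qed

lemma
  fixes v :: "'a::euclidean_space"
  shows integrable_iexp_gaussian: "integrable lborel (\<lambda>x. exp (\<i> * of_real (x \<bullet> v)) * of_real (exp (- (norm x)\<^sup>2 / 2)))"
    and integral_iexp_gaussian: "(\<integral>x. exp (\<i> * of_real (x \<bullet> v)) * of_real (exp (- (norm x)\<^sup>2 / 2)) \<partial>lborel) =
      of_real (sqrt (2 * pi) ^ DIM('a) * exp (- (norm v)\<^sup>2 / 2))"
proof -
  have norm2: "(norm x)\<^sup>2 = (\<Sum>b\<in>Basis. (x \<bullet> b)\<^sup>2)" for x :: 'a
    unfolding power2_norm_eq_inner euclidean_inner[of x x] by (simp add: power2_eq_square)
  have gauss: "exp (- (norm x)\<^sup>2 / 2) = (\<Prod>b\<in>Basis. exp (- (x \<bullet> b)\<^sup>2 / 2))" for x :: 'a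
    unfolding norm2 by (simp add: exp_sum[symmetric] sum_negf sum_divide_distrib)
  have eq: "exp (\<i> * of_real (x \<bullet> v)) * of_real (exp (- (norm x)\<^sup>2 / 2)) =
      (\<Prod>b\<in>Basis. exp (\<i> * of_real ((x \<bullet> b) * (v \<bullet> b))) * of_real (exp (- (x \<bullet> b)\<^sup>2 / 2)))" for x
    unfolding gauss euclidean_inner[of x v] of_real_prod prod.distrib
    by (simp add: exp_sum[symmetric] sum_distrib_left)
  show "integrable lborel (\<lambda>x. exp (\<i> * of_real (x \<bullet> v)) * of_real (exp (- (norm x)\<^sup>2 / 2)))"
    unfolding eq by (rule integrable_lborel_prod[OF integrable_iexp_gaussian_real])
  show "(\<integral>x. exp (\<i> * of_real (x \<bullet> v)) * of_real (exp (- (norm x)\<^sup>2 / 2)) \<partial>lborel) =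
      of_real (sqrt (2 * pi) ^ DIM('a) * exp (- (norm v)\<^sup>2 / 2))"
    unfolding eq integral_lborel_prod[OF integrable_iexp_gaussian_real] integral_iexp_gaussian_real gauss[of v]
    by (simp add: prod.distrib)
qed

lemma integrable_gaussian:
  "integrable lborel (\<lambda>x :: 'a::euclidean_space. complex_of_real (exp (- (norm x)\<^sup>2 / 2)))"
  using integrable_iexp_gaussian[of 0] by simp

lemma integral_gaussian:
  "(\<integral>x. complex_of_real (exp (- (norm (x :: 'a::euclidean_space))\<^sup>2 / 2)) \<partial>lborel) = of_real (sqrt (2 * pi) ^ DIM('a))"
  using integral_iexp_gaussian[of "0 :: 'a"] by simp

text \<open>Fourier inversion by Gaussian summation: with the factor \<open>exp (-\<epsilon>\<^sup>2 |\<xi>|\<^sup>2 / 2)\<close> inserted, Fubini's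
  theorem turns the inverse transform into an average of \<open>\<phi>\<close> around \<open>x\<close> with Gaussian weight of width \<open>\<epsilon>\<close>.\<close>

lemma signed_fourier_inversion_gaussian:
  fixes \<phi> :: "real ^ 'n::finite \<Rightarrow> complex"
  assumes s: "\<bar>s\<bar> = 1" and \<phi>: "\<phi> \<in> schwartz" and e: "0 < e"
  shows "(\<integral>\<xi>. exp (\<i> * of_real (\<xi> \<bullet> (- s *\<^sub>R x))) * signed_fourier s \<phi> \<xi> * of_real (exp (- (norm (e *\<^sub>R \<xi>))\<^sup>2 / 2)) \<partial>lborel) =
    of_real (sqrt (2 * pi) ^ CARD('n)) * (\<integral>u. \<phi> (x + e *\<^sub>R u) * of_real (exp (- (norm u)\<^sup>2 / 2)) \<partial>lborel)"
    (is "?L = _ * ?R")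
proof -
  define g where "g \<xi> = complex_of_real (exp (- (norm (e *\<^sub>R \<xi>))\<^sup>2 / 2))" for \<xi> :: "real ^ 'n"
  \<comment> \<open>The phases of the two transforms combine to \<xi> \<bullet> s (y - x).
    Integrating in y recovers the transform of \<phi>; integrating in \<xi> leaves a Gaussian in y
    centred at x.\<close>
  define F where "F \<xi> y = exp (\<i> * of_real (\<xi> \<bullet> (s *\<^sub>R (y - x)))) * g \<xi> * \<phi> y" for \<xi> y
  have [measurable]: "\<phi> \<in> borel_measurable borel" "g \<in> borel_measurable borel"
    using \<phi> by (auto dest: schwartz_measurable simp: g_def[abs_def])
  have g: "integrable lborel g"
    using integrable_lborel_affine_iff[of e "\<lambda>\<xi> :: real ^ 'n. complex_of_real (exp (- (norm \<xi>)\<^sup>2 / 2))" 0]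
      e integrable_gaussian[where 'a = "real ^ 'n"] by (simp add: g_def[abs_def])
  have nF: "norm (F \<xi> y) = norm (g \<xi>) * norm (\<phi> y)" for \<xi> y
    by (simp add: F_def norm_mult)
  have F [measurable]: "case_prod F \<in> borel_measurable (lborel \<Otimes>\<^sub>M lborel)"
    unfolding F_def by measurable
  have "integrable (lborel \<Otimes>\<^sub>M lborel) (case_prod F)"
  proof (rule lborel_pair.Fubini_integrable[OF F])
    show "integrable lborel (\<lambda>\<xi>. \<integral>y. norm (case_prod F (\<xi>, y)) \<partial>lborel)"
      using g by (simp add: nF)
    show "AE \<xi> in lborel. integrable lborel (\<lambda>y. case_prod F (\<xi>, y))"
    proof (rule AE_I2)
      fix \<xi>
      have "integrable lborel (\<lambda>y. norm (g \<xi>) * norm (\<phi> y))"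
        using schwartz_integrable[OF \<phi>] by (intro integrable_mult_right integrable_norm)
      then show "integrable lborel (\<lambda>y. case_prod F (\<xi>, y))"
      proof (rule Bochner_Integration.integrable_bound)
        show "(\<lambda>y. case_prod F (\<xi>, y)) \<in> borel_measurable lborel"
          by (simp add: F_def)
      qed (simp add: nF)
    qed
  qed
  then have swap: "(\<integral>\<xi>. (\<integral>y. F \<xi> y \<partial>lborel) \<partial>lborel) = (\<integral>y. (\<integral>\<xi>. F \<xi> y \<partial>lborel) \<partial>lborel)"
    by (rule lborel_pair.Fubini_integral[symmetric])
  have left: "(\<integral>y. F \<xi> y \<partial>lborel) = exp (\<i> * of_real (\<xi> \<bullet> (- s *\<^sub>R x))) * signed_fourier s \<phi> \<xi> * g \<xi>" for \<xi>
  proof -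
    have "F \<xi> y = (exp (\<i> * of_real (\<xi> \<bullet> (- s *\<^sub>R x))) * g \<xi>) * (exp (\<i> * of_real (y \<bullet> (s *\<^sub>R \<xi>))) * \<phi> y)" for y
      by (simp add: F_def exp_add[symmetric] algebra_simps inner_diff_right inner_commute)
    then show ?thesis
      by (simp add: signed_fourier_def)
  qed
  have right: "(\<integral>\<xi>. F \<xi> y \<partial>lborel) = of_real (sqrt (2 * pi) ^ CARD('n) * exp (- (norm ((y - x) /\<^sub>R e))\<^sup>2 / 2) / e ^ CARD('n)) * \<phi> y" for y
  proof -
    define v where "v = (s / e) *\<^sub>R (y - x)"
    have nv: "norm v = norm ((y - x) /\<^sub>R e)"
      using s e by (simp add: v_def abs_mult divide_inverse)
    have "(\<integral>\<xi>. F \<xi> y \<partial>lborel) = (\<integral>\<xi>. exp (\<i> * of_real ((e *\<^sub>R \<xi>) \<bullet> v)) * of_real (exp (- (norm (e *\<^sub>R \<xi>))\<^sup>2 / 2)) \<partial>lborel) * \<phi> y"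
      using e by (simp add: F_def g_def v_def)
    also have "(\<integral>\<xi>. exp (\<i> * of_real ((e *\<^sub>R \<xi>) \<bullet> v)) * of_real (exp (- (norm (e *\<^sub>R \<xi>))\<^sup>2 / 2)) \<partial>lborel) =
        (\<integral>\<xi>. exp (\<i> * of_real (\<xi> \<bullet> v)) * of_real (exp (- (norm \<xi>)\<^sup>2 / 2)) \<partial>lborel) /\<^sub>R e ^ CARD('n)"
      using e integral_lborel_affine[of e "\<lambda>\<xi>. exp (\<i> * of_real (\<xi> \<bullet> v)) * of_real (exp (- (norm \<xi>)\<^sup>2 / 2))" 0]
      by simp
    also have "\<dots> = of_real (sqrt (2 * pi) ^ CARD('n) * exp (- (norm v)\<^sup>2 / 2)) /\<^sub>R e ^ CARD('n)"
      by (subst integral_iexp_gaussian) simp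
    also have "\<dots> = of_real (sqrt (2 * pi) ^ CARD('n) * exp (- (norm v)\<^sup>2 / 2) / e ^ CARD('n))"
      by (simp only: scaleR_conv_of_real of_real_mult[symmetric] divide_inverse mult.commute)
    finally show ?thesis
      unfolding nv .
  qed
  have "?L = (\<integral>y. (\<integral>\<xi>. F \<xi> y \<partial>lborel) \<partial>lborel)"
    unfolding swap[symmetric] left by (simp add: g_def)
  \<comment> \<open>With y = x + e u the Jacobian \<open>e ^ CARD('n)\<close> cancels the same
    factor in \<open>right\<close>.\<close>
  also have "\<dots> = e ^ CARD('n) *\<^sub>R (\<integral>u. (\<integral>\<xi>. F \<xi> (x + e *\<^sub>R u) \<partial>lborel) \<partial>lborel)"
    using e integral_lborel_affine[of e "\<lambda>y. \<integral>\<xi>. F \<xi> y \<partial>lborel" x] by (simp add: right)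
  also have "\<dots> = of_real (sqrt (2 * pi) ^ CARD('n)) * ?R"
  proof -
    have "(\<integral>\<xi>. F \<xi> (x + e *\<^sub>R u) \<partial>lborel) = of_real (sqrt (2 * pi) ^ CARD('n) / e ^ CARD('n)) *
        (\<phi> (x + e *\<^sub>R u) * of_real (exp (- (norm u)\<^sup>2 / 2)))" for u
      unfolding right using e by simp
    then show ?thesis
      using e by (simp add: scaleR_conv_of_real)
  qed
  finally show ?thesis .
qed

text \<open>Both sides of the Gaussian identity converge as the width tends to 0, dominated by the
  integrable transform on one side and by a bound of |\<phi>| times a fixed Gaussian on the other.
  One factor sqrt (2 pi)^n comes from transforming the Gaussian, the other from its mass.\<close>

theorem signed_fourier_inversion:
  fixes \<phi> :: "real ^ 'n::finite \<Rightarrow> complex"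
  assumes s: "\<bar>s\<bar> = 1" and \<phi>: "\<phi> \<in> schwartz"
  shows "signed_fourier (- s) (signed_fourier s \<phi>) x = of_real ((2 * pi) ^ CARD('n)) * \<phi> x"
proof -
  define e where "e k = inverse (real (Suc k))" for k
  have e: "0 < e k" for k by (simp add: e_def)
  have e0: "e \<longlonglongrightarrow> 0"
    unfolding e_def[abs_def] by (rule LIMSEQ_inverse_real_of_nat)
  have F: "signed_fourier s \<phi> \<in> schwartz"
    using s \<phi> by (rule signed_fourier_schwartz)
  have [measurable]: "\<phi> \<in> borel_measurable borel" "signed_fourier s \<phi> \<in> borel_measurable borel"
    using \<phi> F by (auto dest: schwartz_measurable)
  let ?g = "\<lambda>\<xi> :: real ^ 'n. complex_of_real (exp (- (norm \<xi>)\<^sup>2 / 2))"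
  have g1: "norm (?g \<xi>) \<le> 1" for \<xi> by simp
  have "(\<lambda>k. \<integral>\<xi>. exp (\<i> * of_real (\<xi> \<bullet> (- s *\<^sub>R x))) * signed_fourier s \<phi> \<xi> * ?g (e k *\<^sub>R \<xi>) \<partial>lborel)
      \<longlonglongrightarrow> (\<integral>\<xi>. exp (\<i> * of_real (\<xi> \<bullet> (- s *\<^sub>R x))) * signed_fourier s \<phi> \<xi> \<partial>lborel)"
  proof (rule integral_dominated_convergence)
    show "integrable lborel (\<lambda>\<xi>. norm (signed_fourier s \<phi> \<xi>))"
      using schwartz_integrable[OF F] by (rule integrable_norm)
    show "AE \<xi> in lborel. (\<lambda>k. exp (\<i> * of_real (\<xi> \<bullet> (- s *\<^sub>R x))) * signed_fourier s \<phi> \<xi> * ?g (e k *\<^sub>R \<xi>))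
        \<longlonglongrightarrow> exp (\<i> * of_real (\<xi> \<bullet> (- s *\<^sub>R x))) * signed_fourier s \<phi> \<xi>"
    proof (rule AE_I2)
      fix \<xi> :: "real ^ 'n"
      have "(\<lambda>k. exp (\<i> * of_real (\<xi> \<bullet> (- s *\<^sub>R x))) * signed_fourier s \<phi> \<xi> * ?g (e k *\<^sub>R \<xi>))
          \<longlonglongrightarrow> exp (\<i> * of_real (\<xi> \<bullet> (- s *\<^sub>R x))) * signed_fourier s \<phi> \<xi> * ?g (0 *\<^sub>R \<xi>)"
        by (intro tendsto_intros e0) simp
      then show "(\<lambda>k. exp (\<i> * of_real (\<xi> \<bullet> (- s *\<^sub>R x))) * signed_fourier s \<phi> \<xi> * ?g (e k *\<^sub>R \<xi>))
          \<longlonglongrightarrow> exp (\<i> * of_real (\<xi> \<bullet> (- s *\<^sub>R x))) * signed_fourier s \<phi> \<xi>" by simp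
    qed
    show "AE \<xi> in lborel. norm (exp (\<i> * of_real (\<xi> \<bullet> (- s *\<^sub>R x))) * signed_fourier s \<phi> \<xi> * ?g (e k *\<^sub>R \<xi>))
        \<le> norm (signed_fourier s \<phi> \<xi>)" for k
    proof (rule AE_I2)
      fix \<xi> :: "real ^ 'n"
      show "norm (exp (\<i> * of_real (\<xi> \<bullet> (- s *\<^sub>R x))) * signed_fourier s \<phi> \<xi> * ?g (e k *\<^sub>R \<xi>))
          \<le> norm (signed_fourier s \<phi> \<xi>)"
        unfolding norm_mult norm_exp_i_times mult_1_left
        using g1 norm_ge_zero by (rule mult_left_le)
    qed
  qed measurable
  then have 1: "(\<lambda>k. of_real (sqrt (2 * pi) ^ CARD('n)) * (\<integral>u. \<phi> (x + e k *\<^sub>R u) * ?g u \<partial>lborel))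
      \<longlonglongrightarrow> signed_fourier (- s) (signed_fourier s \<phi>) x"
    unfolding signed_fourier_inversion_gaussian[OF s \<phi> e] signed_fourier_def[of "- s"] .
  have "(\<lambda>k. \<integral>u. \<phi> (x + e k *\<^sub>R u) * ?g u \<partial>lborel) \<longlonglongrightarrow> (\<integral>u. \<phi> x * ?g u \<partial>lborel)"
  proof (rule integral_dominated_convergence)
    show "integrable lborel (\<lambda>u. schwartz_norm 0 \<phi> * norm (?g u))"
      by (intro integrable_mult_right integrable_norm integrable_gaussian)
    show "AE u in lborel. (\<lambda>k. \<phi> (x + e k *\<^sub>R u) * ?g u) \<longlonglongrightarrow> \<phi> x * ?g u"
    proof (rule AE_I2)
      fix u
      have "(\<lambda>k. x + e k *\<^sub>R u) \<longlonglongrightarrow> x + 0 *\<^sub>R u"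
        by (intro tendsto_intros e0)
      then have "(\<lambda>k. \<phi> (x + e k *\<^sub>R u)) \<longlonglongrightarrow> \<phi> x"
        using isCont_tendsto_compose[OF schwartz_isCont[OF \<phi>]] by simp
      then show "(\<lambda>k. \<phi> (x + e k *\<^sub>R u) * ?g u) \<longlonglongrightarrow> \<phi> x * ?g u"
        by (intro tendsto_intros)
    qed
    show "AE u in lborel. norm (\<phi> (x + e k *\<^sub>R u) * ?g u) \<le> schwartz_norm 0 \<phi> * norm (?g u)" for k
      using schwartz_le_weight[OF \<phi>, of _ 0]
      by (intro AE_I2) (simp add: norm_mult mult_right_mono)
  qed measurable
  then have "(\<lambda>k. of_real (sqrt (2 * pi) ^ CARD('n)) * (\<integral>u. \<phi> (x + e k *\<^sub>R u) * ?g u \<partial>lborel))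
      \<longlonglongrightarrow> of_real (sqrt (2 * pi) ^ CARD('n)) * (\<phi> x * of_real (sqrt (2 * pi) ^ CARD('n)))"
    using integral_gaussian[where 'a = "real ^ 'n"] by (intro tendsto_intros) simp
  with 1 have "signed_fourier (- s) (signed_fourier s \<phi>) x =
      of_real (sqrt (2 * pi) ^ CARD('n)) * (\<phi> x * of_real (sqrt (2 * pi) ^ CARD('n)))"
    by (rule LIMSEQ_unique)
  also have "\<dots> = of_real (sqrt (2 * pi) ^ CARD('n) * sqrt (2 * pi) ^ CARD('n)) * \<phi> x"
    by (simp only: of_real_mult mult_ac)
  also have "sqrt (2 * pi) ^ CARD('n) * sqrt (2 * pi) ^ CARD('n) = (2 * pi) ^ CARD('n)"
    unfolding power_mult_distrib[symmetric] by (subst real_sqrt_mult_self) simp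
  finally show ?thesis .
qed

section \<open>The two transforms as inverses of each other on the Schwartz space\<close>

lemma fourier_eq_signed_fourier: "fourier \<phi> = signed_fourier (- 1) \<phi>"
  by (simp add: fun_eq_iff fourier_def signed_fourier_def mult.commute)

lemma inv_fourier_eq_signed_fourier:
  "inv_fourier (\<psi> :: real ^ 'n::finite \<Rightarrow> complex) = (\<lambda>x. of_real (1 / (2 * pi) ^ CARD('n)) * signed_fourier 1 \<psi> x)"
  by (simp add: fun_eq_iff inv_fourier_def signed_fourier_def inner_commute mult.commute)

lemma inv_fourier_schwartz: "\<phi> \<in> schwartz \<Longrightarrow> inv_fourier \<phi> \<in> schwartz"
  by (simp only: inv_fourier_eq_signed_fourier) (intro schwartz_const_mult signed_fourier_schwartz; simp)

lemma inv_fourier_fourier: "\<phi> \<in> schwartz \<Longrightarrow> inv_fourier (fourier \<phi>) = \<phi>"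
  using signed_fourier_inversion[of "- 1" \<phi>]
  by (simp add: fun_eq_iff inv_fourier_eq_signed_fourier fourier_eq_signed_fourier)

lemma fourier_inv_fourier: "\<phi> \<in> schwartz \<Longrightarrow> fourier (inv_fourier \<phi>) = \<phi>"
  unfolding fun_eq_iff inv_fourier_eq_signed_fourier fourier_eq_signed_fourier signed_fourier_const_mult
  using signed_fourier_inversion[of 1 \<phi>] by simp

section \<open>Functions annihilated by all Schwartz functions\<close>

lemma real_polynomial_function_derivative:
  assumes "real_polynomial_function p"
  shows "\<exists>D. (\<forall>x. (p has_derivative D x) (at x)) \<and> (\<forall>h. real_polynomial_function (\<lambda>x. D x h))"
  using assms
proof (induction rule: real_polynomial_function.induct)
  case (linear f)
  then show ?case
    by (intro exI[of _ "\<lambda>_. f"]) (auto intro: bounded_linear_imp_has_derivative)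
next
  case (const c)
  then show ?case by (intro exI[of _ "\<lambda>_ _. 0"]) auto
next
  case (add f g)
  then obtain F G where "\<And>x. (f has_derivative F x) (at x)" "\<And>h. real_polynomial_function (\<lambda>x. F x h)"
    "\<And>x. (g has_derivative G x) (at x)" "\<And>h. real_polynomial_function (\<lambda>x. G x h)" by blast
  then show ?case
    by (intro exI[of _ "\<lambda>x h. F x h + G x h"]) (auto intro: has_derivative_add)
next
  case (mult f g)
  then obtain F G where "\<And>x. (f has_derivative F x) (at x)" "\<And>h. real_polynomial_function (\<lambda>x. F x h)"
    "\<And>x. (g has_derivative G x) (at x)" "\<And>h. real_polynomial_function (\<lambda>x. G x h)" by blast
  then show ?case
    using mult.hyps by (intro exI[of _ "\<lambda>x h. f x * G x h + F x h * g x"])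
      (auto intro!: has_derivative_mult real_polynomial_function.intros(3,4))
qed

lemma real_polynomial_function_growth:
  fixes p :: "'a::real_normed_vector \<Rightarrow> real"
  assumes "real_polynomial_function p"
  shows "\<exists>C k. 0 \<le> C \<and> (\<forall>x. \<bar>p x\<bar> \<le> C * (1 + norm x) ^ k)"
  using assms
proof (induction rule: real_polynomial_function.induct)
  case (linear f)
  then obtain K where K: "0 < K" "\<And>x. norm (f x) \<le> norm x * K"
    using bounded_linear.pos_bounded by blast
  have "\<bar>f x\<bar> \<le> K * (1 + norm x) ^ 1" for x
    using K(2)[of x] K(1) by (simp add: algebra_simps)
  then show ?case using K(1) less_imp_le by blast
next
  case (const c)
  have "\<bar>c\<bar> \<le> \<bar>c\<bar> * (1 + norm x) ^ 0" for x :: 'a by simp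
  then show ?case using abs_ge_zero by blast
next
  case (add f g)
  then obtain C k D l where C: "0 \<le> C" "\<And>x. \<bar>f x\<bar> \<le> C * (1 + norm x) ^ k"
    and D: "0 \<le> D" "\<And>x. \<bar>g x\<bar> \<le> D * (1 + norm x) ^ l" by blast
  have "\<bar>f x + g x\<bar> \<le> (C + D) * (1 + norm x) ^ (k + l)" for x
  proof -
    have "(1 + norm x) ^ k \<le> (1 + norm x) ^ (k + l)" "(1 + norm x) ^ l \<le> (1 + norm x) ^ (k + l)"
      by (auto intro!: power_increasing)
    then have "C * (1 + norm x) ^ k \<le> C * (1 + norm x) ^ (k + l)" "D * (1 + norm x) ^ l \<le> D * (1 + norm x) ^ (k + l)"
      using C(1) D(1) by (auto intro: mult_left_mono)
    then show ?thesis
      using C(2)[of x] D(2)[of x] unfolding distrib_right by linarith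
  qed
  then show ?case using C(1) D(1) by (meson add_nonneg_nonneg)
next
  case (mult f g)
  then obtain C k D l where C: "0 \<le> C" "\<And>x. \<bar>f x\<bar> \<le> C * (1 + norm x) ^ k"
    and D: "0 \<le> D" "\<And>x. \<bar>g x\<bar> \<le> D * (1 + norm x) ^ l" by blast
  have "\<bar>f x * g x\<bar> \<le> (C * D) * (1 + norm x) ^ (k + l)" for x
  proof -
    have "\<bar>f x\<bar> * \<bar>g x\<bar> \<le> (C * (1 + norm x) ^ k) * (D * (1 + norm x) ^ l)"
      by (rule mult_mono[OF C(2) D(2)]) (use C(1) in auto)
    then show ?thesis by (simp add: abs_mult power_add mult_ac)
  qed
  then show ?case using C(1) D(1) by (meson mult_nonneg_nonneg)
qed

text \<open>A single term of the exponential series gives (1 + u)^k \<le> k! exp (1 + u), and 1 + u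
  - u^2 \<le> 2 by completing the square.\<close>

lemma power_exp_neg_square_le:
  fixes u :: real
  assumes "0 \<le> u"
  shows "(1 + u) ^ k * exp (- u\<^sup>2) \<le> fact k * exp 2"
proof -
  have "(1 + u) ^ k / fact k \<le> exp (1 + u)"
    using sum_le_suminf[OF summable_exp_generic[of "1 + u"], of "{k}"] assms
    by (simp add: exp_def divide_inverse mult.commute)
  then have "(1 + u) ^ k \<le> fact k * exp (1 + u)"
    by (simp add: field_simps)
  then have "(1 + u) ^ k * exp (- u\<^sup>2) \<le> fact k * exp (1 + u) * exp (- u\<^sup>2)"
    by (rule mult_right_mono) simp
  also have "\<dots> = fact k * exp (1 + u - u\<^sup>2)"
    by (simp add: exp_add[symmetric])
  also have "\<dots> \<le> fact k * exp 2"
  proof (intro mult_left_mono, subst exp_le_cancel_iff)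
    have "0 \<le> (u - 1 / 2)\<^sup>2" by simp
    then show "1 + u - u\<^sup>2 \<le> 2" by (simp add: power2_diff power_divide)
  qed simp
  finally show ?thesis .
qed

text \<open>For fixed \<open>r\<close> the functions q exp (- r) are stable under partial
  derivatives, the new factor being the derivative of q minus q times the derivative of r. Since
  \<open>r\<close> dominates the squared norm, Gaussian decay beats the polynomial growth of
  q.\<close>

lemma polynomial_exp_schwartz:
  fixes q r :: "real ^ 'n::finite \<Rightarrow> real"
  assumes q: "real_polynomial_function q" and r: "real_polynomial_function r"
    and ge: "\<And>x. (norm x)\<^sup>2 \<le> r x"
  shows "(\<lambda>x. complex_of_real (q x * exp (- r x))) \<in> schwartz"
proof (rule schwartz_coinduct[of _ "{(\<lambda>x. complex_of_real (q x * exp (- r x))) | q. real_polynomial_function q}"])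
  obtain R where R: "\<And>x. (r has_derivative R x) (at x)" "\<And>h. real_polynomial_function (\<lambda>x. R x h)"
    using real_polynomial_function_derivative[OF r] by blast
  fix f :: "real ^ 'n \<Rightarrow> complex" assume "f \<in> {(\<lambda>x. complex_of_real (q x * exp (- r x))) | q. real_polynomial_function q}"
  then obtain q where q: "real_polynomial_function q" and f: "f = (\<lambda>x. complex_of_real (q x * exp (- r x)))"
    by blast
  obtain D where D: "\<And>x. (q has_derivative D x) (at x)" "\<And>h. real_polynomial_function (\<lambda>x. D x h)"
    using real_polynomial_function_derivative[OF q] by blast
  have deriv: "(f has_derivative (\<lambda>h. complex_of_real ((D x h - q x * R x h) * exp (- r x)))) (at x)" for x
    unfolding f by (auto intro!: derivative_eq_intros D R simp: algebra_simps)
  then show "f differentiable (at x)" for x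
    using differentiable_def by blast
  show "partials [j] f \<in> {(\<lambda>x. complex_of_real (q x * exp (- r x))) | q. real_polynomial_function q}" for j
    unfolding partials_singleton_eqI[OF deriv]
    using D(2) R(2) q by (intro CollectI exI[of _ "\<lambda>x. D x (axis j 1) - q x * R x (axis j 1)"] conjI refl
        real_polynomial_function_diff real_polynomial_function.intros(4))
  show "bounded (range (\<lambda>x. (1 + norm x) ^ k * norm (f x)))" for k
  proof -
    obtain C l where C: "0 \<le> C" "\<And>x. \<bar>q x\<bar> \<le> C * (1 + norm x) ^ l"
      using real_polynomial_function_growth[OF q] by blast
    have "(1 + norm x) ^ k * norm (f x) \<le> C * (fact (k + l) * exp 2)" for x
    proof -
      have "norm (f x) \<le> (C * (1 + norm x) ^ l) * exp (- (norm x)\<^sup>2)"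
        unfolding f norm_of_real abs_mult abs_exp_cancel
        by (rule mult_mono[OF C(2)]) (use ge[of x] C(1) in auto)
      then have "(1 + norm x) ^ k * norm (f x) \<le> (1 + norm x) ^ k * ((C * (1 + norm x) ^ l) * exp (- (norm x)\<^sup>2))"
        by (rule mult_left_mono) simp
      also have "\<dots> = C * ((1 + norm x) ^ (k + l) * exp (- (norm x)\<^sup>2))"
        by (simp add: power_add mult_ac)
      also have "\<dots> \<le> C * (fact (k + l) * exp 2)"
        using C(1) by (intro mult_left_mono power_exp_neg_square_le) auto
      finally show ?thesis .
    qed
    then show ?thesis using bounded_range_weight_iff by blast
  qed
qed (use q in blast)

section \<open>Boxes and their approximation\<close>

lemma real_polynomial_function_inner_left: "real_polynomial_function (\<lambda>x. x \<bullet> b)"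
  by (intro real_polynomial_function.intros(1) bounded_linear_inner_left)

lemma real_polynomial_function_norm_square:
  "real_polynomial_function (\<lambda>x :: 'a::euclidean_space. (norm x)\<^sup>2)"
proof -
  have "(norm x)\<^sup>2 = (\<Sum>b\<in>Basis. (x \<bullet> b) * (x \<bullet> b))" for x :: 'a
    unfolding power2_norm_eq_inner by (rule euclidean_inner)
  then show ?thesis
    by (simp only:) (intro real_polynomial_function_sum real_polynomial_function.intros(4)
        real_polynomial_function_inner_left finite_Basis)
qed

text \<open>The map \<open>y i\<close> sends the edge of the box in direction i affinely onto (-1,
  1). Inside the box every summand k (y i)^(2k) of the exponent tends to 0; outside, one of them is
  at least k. The factor k matters on the boundary, where the powers alone could stay equal to
  1.\<close>

lemma box_indicator_limit:
  fixes a b :: "'a::euclidean_space"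
  assumes ne: "\<And>i. i \<in> Basis \<Longrightarrow> a \<bullet> i < b \<bullet> i"
  obtains p :: "nat \<Rightarrow> 'a \<Rightarrow> real" where
    "\<And>k. real_polynomial_function (p k)" "\<And>k x. 0 \<le> p k x"
    "\<And>x. (\<lambda>k. exp (- p k x)) \<longlonglongrightarrow> indicator (box a b) x"
proof
  define y where "y i x = (2 * (x \<bullet> i) - (a + b) \<bullet> i) / ((b - a) \<bullet> i)" for i x
  define p where "p k x = real k * (\<Sum>i\<in>Basis. ((y i x)\<^sup>2) ^ k)" for k x
  show "real_polynomial_function (p k)" for k
    unfolding p_def y_def
    by (intro real_polynomial_function.intros(4) real_polynomial_function.intros(2) real_polynomial_function_sum
        real_polynomial_function_power real_polynomial_function_divide real_polynomial_function_diff
        real_polynomial_function_inner_left finite_Basis)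
  show "0 \<le> p k x" for k x
    unfolding p_def by (intro mult_nonneg_nonneg sum_nonneg) auto
  show "(\<lambda>k. exp (- p k x)) \<longlonglongrightarrow> indicator (box a b) x" for x
  proof -
    have y1: "(y i x)\<^sup>2 < 1 \<longleftrightarrow> a \<bullet> i < x \<bullet> i \<and> x \<bullet> i < b \<bullet> i" if "i \<in> Basis" for i
    proof -
      have "(y i x)\<^sup>2 < 1 \<longleftrightarrow> \<bar>y i x\<bar> < 1"
        by (simp add: abs_square_less_1)
      also have "\<dots> \<longleftrightarrow> - 1 < y i x \<and> y i x < 1" by auto
      also have "\<dots> \<longleftrightarrow> a \<bullet> i < x \<bullet> i \<and> x \<bullet> i < b \<bullet> i"
        using ne[OF that] by (simp add: y_def inner_diff_left inner_add_left pos_less_divide_eq pos_divide_less_eq)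
      finally show ?thesis .
    qed
    show ?thesis
    proof (cases "x \<in> box a b")
      case True
      have "(\<lambda>k. p k x) \<longlonglongrightarrow> (\<Sum>i\<in>(Basis :: 'a set). 0)"
        unfolding p_def sum_distrib_left
      proof (rule tendsto_sum)
        fix i :: 'a assume "i \<in> Basis"
        then have "norm ((y i x)\<^sup>2) < 1"
          using True y1 by (auto simp: mem_box)
        then show "(\<lambda>k. real k * ((y i x)\<^sup>2) ^ k) \<longlonglongrightarrow> 0"
          by (rule powser_times_n_limit_0)
      qed
      then have "(\<lambda>k. exp (- p k x)) \<longlonglongrightarrow> exp (- 0)"
        by (intro tendsto_intros) simp
      then show ?thesis using True by simp
    next
      case False
      then obtain i where i: "i \<in> Basis" "\<not> (y i x)\<^sup>2 < 1"
        using y1 by (auto simp: mem_box)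
      have le: "exp (- p k x) \<le> exp (- 1) ^ k" for k
      proof -
        have "1 \<le> ((y i x)\<^sup>2) ^ k"
          by (rule one_le_power) (use i(2) in \<open>simp only: not_less\<close>)
        also have "\<dots> \<le> (\<Sum>i\<in>Basis. ((y i x)\<^sup>2) ^ k)"
          using i(1) by (intro member_le_sum) auto
        finally have "real k * 1 \<le> p k x"
          unfolding p_def by (rule mult_left_mono) simp
        then show ?thesis by (simp add: exp_of_nat_mult[symmetric])
      qed
      have "(\<lambda>k. exp (- p k x)) \<longlonglongrightarrow> 0"
      proof (rule tendsto_sandwich[of "\<lambda>_. 0"])
        show "\<forall>\<^sub>F k in sequentially. exp (- p k x) \<le> exp (- 1) ^ k"
          using le by simp
        show "(\<lambda>k. exp (- 1) ^ k :: real) \<longlonglongrightarrow> 0"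
          by (rule LIMSEQ_realpow_zero) auto
      qed auto
      then show ?thesis using False by simp
    qed
  qed
qed

text \<open>Boxes form an intersection-stable generator of the Borel sets, so Dynkin's argument
  extends vanishing integrals to all Borel sets, which forces the function to vanish almost
  everywhere. The complement step uses the integral over the whole space, obtained from an
  increasing sequence of boxes.\<close>

lemma AE_eq_0_if_box_integrals_eq_0:
  fixes g :: "'a::euclidean_space \<Rightarrow> 'b::{banach, second_countable_topology}"
  assumes g: "integrable lborel g"
    and box: "\<And>a b. (\<integral>x. indicator (box a b) x *\<^sub>R g x \<partial>lborel) = 0"
  shows "AE x in lborel. g x = 0"
proof (rule sigma_finite_measure.density_zero[OF sigma_finite_lborel g])
  have int: "integrable lborel (\<lambda>x. indicator A x *\<^sub>R g x)" if "A \<in> sets borel" for A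
    using that g by (intro integrable_mult_indicator) auto
  have UNIV0: "(\<integral>x. g x \<partial>lborel) = 0"
  proof -
    have "(\<lambda>k. \<integral>x. indicator (box (- (real k *\<^sub>R One)) (real k *\<^sub>R One)) x *\<^sub>R g x \<partial>lborel) \<longlonglongrightarrow> (\<integral>x. g x \<partial>lborel)"
    proof (rule integral_dominated_convergence)
      show "integrable lborel (\<lambda>x. norm (g x))" using g by (rule integrable_norm)
      show "AE x in lborel. (\<lambda>k. indicator (box (- (real k *\<^sub>R One)) (real k *\<^sub>R One)) x *\<^sub>R g x) \<longlonglongrightarrow> g x"
      proof (rule AE_I2, rule tendsto_eventually)
        fix x :: 'a
        obtain N :: nat where N: "norm x < real N" using reals_Archimedean2 by blast
        show "\<forall>\<^sub>F k in sequentially. indicator (box (- (real k *\<^sub>R One)) (real k *\<^sub>R One)) x *\<^sub>R g x = g x"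
        proof (rule eventually_sequentiallyI)
          fix k assume k: "N \<le> k"
          have "\<bar>x \<bullet> i\<bar> < real k" if "i \<in> Basis" for i
            using Basis_le_norm[OF that, of x] N k by linarith
          then have "x \<in> box (- (real k *\<^sub>R One)) (real k *\<^sub>R One)"
            by (auto simp: mem_box abs_less_iff minus_less_iff)
          then show "indicator (box (- (real k *\<^sub>R One)) (real k *\<^sub>R One)) x *\<^sub>R g x = g x" by simp
        qed
      qed
    qed (use g in \<open>auto simp: indicator_def\<close>)
    then show ?thesis by (simp add: box LIMSEQ_const_iff)
  qed
  fix A :: "'a set" assume "A \<in> sets lborel"
  then have A: "A \<in> sigma_sets UNIV (range (\<lambda>(a, b). box a b))"
    by (simp add: borel_eq_box)
  have "Int_stable (range (\<lambda>(a, b). box a b :: 'a set))"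
    by (auto simp: Int_stable_def box_Int_box)
  moreover have "range (\<lambda>(a, b). box a b :: 'a set) \<subseteq> Pow UNIV"
    by simp
  ultimately show "set_lebesgue_integral lborel A g = 0"
    using A unfolding set_lebesgue_integral_def
  proof (induction rule: sigma_sets_induct_disjoint)
    case (compl A)
    have A: "A \<in> sets borel" using compl.hyps by (simp add: borel_eq_box)
    have "indicator (UNIV - A) x *\<^sub>R g x = g x - indicator A x *\<^sub>R g x" for x
      by (auto simp: indicator_def)
    then show ?case
      using compl.IH UNIV0 int[OF A] g by simp
  next
    case (union A)
    have A: "A i \<in> sets borel" for i using union.hyps by (auto simp: borel_eq_box)
    have "(LINT x:(\<Union>i. A i)|lborel. g x) = (\<Sum>i. (LINT x:(A i)|lborel. g x))"
      using union.hyps A int[of "\<Union>i. A i"]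
      by (intro lebesgue_integral_countable_add) (auto simp: disjoint_family_on_def set_integrable_def)
    then show ?case using union.IH by (simp add: set_lebesgue_integral_def)
  qed (auto simp: box)
qed

lemma mult_cscalar_of_real: "x * cscalar (of_real c) = c *\<^sub>R x"
  unfolding cscalar_of_real by (simp add: of_real_def)

text \<open>Functions of the form \<open>exp (- |x|\<^sup>2 - p x)\<close> with \<open>p\<close> a nonnegative polynomial are Schwartz and
  approximate \<open>exp (- |x|\<^sup>2)\<close> times the indicator of a box.\<close>

lemma AE_eq_0_if_schwartz_integrals_eq_0:
  fixes f :: "real ^ 'n::finite \<Rightarrow> 'n cclifford"
  assumes int: "\<And>\<phi>. \<phi> \<in> schwartz \<Longrightarrow> integrable lborel (\<lambda>x. f x * cscalar (\<phi> x))"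
    and zero: "\<And>\<phi>. \<phi> \<in> schwartz \<Longrightarrow> (\<integral>x. f x * cscalar (\<phi> x) \<partial>lborel) = 0"
  shows "AE x in lborel. f x = 0"
proof -
  \<comment> \<open>Only products of \<open>f\<close> with test functions are known to be
    integrable, so a Gaussian is built in: \<open>g\<close> is itself integrable, by the case p = 0
    of \<open>test\<close>, and vanishes exactly where \<open>f\<close> does.\<close>
  define g where "g x = exp (- (norm x)\<^sup>2) *\<^sub>R f x" for x
  have test: "integrable lborel (\<lambda>x. exp (- p x) *\<^sub>R g x) \<and> (\<integral>x. exp (- p x) *\<^sub>R g x \<partial>lborel) = 0"
    if p: "real_polynomial_function p" "\<And>x. 0 \<le> p x" for p
  proof -
    have S: "(\<lambda>x. complex_of_real (1 * exp (- ((norm x)\<^sup>2 + p x)))) \<in> schwartz"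
      by (intro polynomial_exp_schwartz real_polynomial_function.intros(2,3) real_polynomial_function_norm_square p)
        (simp add: p)
    have eq: "exp (- p x) *\<^sub>R g x = f x * cscalar (complex_of_real (1 * exp (- ((norm x)\<^sup>2 + p x))))" for x
      unfolding mult_cscalar_of_real g_def by (simp add: exp_add[symmetric])
    show ?thesis
      unfolding eq using int[OF S] zero[OF S] by blast
  qed
  have g: "integrable lborel g"
    using test[of "\<lambda>_. 0"] by (simp add: real_polynomial_function.intros(2))
  have "AE x in lborel. g x = 0"
  proof (rule AE_eq_0_if_box_integrals_eq_0[OF g])
    fix a b :: "real ^ 'n"
    show "(\<integral>x. indicator (box a b) x *\<^sub>R g x \<partial>lborel) = 0"
    proof (cases "\<forall>i\<in>Basis. a \<bullet> i < b \<bullet> i")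
      case False
      then have "box a b = {}" by (auto simp: box_eq_empty not_less)
      then show ?thesis by simp
    next
      case True
      then obtain p where p: "\<And>k. real_polynomial_function (p k)" "\<And>k x. 0 \<le> p k x"
        "\<And>x. (\<lambda>k. exp (- p k x)) \<longlonglongrightarrow> indicator (box a b) x"
        using box_indicator_limit[of a b] by blast
      have "(\<lambda>k. \<integral>x. exp (- p k x) *\<^sub>R g x \<partial>lborel) \<longlonglongrightarrow> (\<integral>x. indicator (box a b) x *\<^sub>R g x \<partial>lborel)"
      proof (rule integral_dominated_convergence)
        show "integrable lborel (\<lambda>x. norm (g x))" using g by (rule integrable_norm)
        show "AE x in lborel. (\<lambda>k. exp (- p k x) *\<^sub>R g x) \<longlonglongrightarrow> indicator (box a b) x *\<^sub>R g x"
          by (intro AE_I2 tendsto_intros p)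
        show "AE x in lborel. norm (exp (- p k x) *\<^sub>R g x) \<le> norm (g x)" for k
          using p(2) by (intro AE_I2) (simp add: mult_left_le_one_le)
        show "(\<lambda>x. exp (- p k x) *\<^sub>R g x) \<in> borel_measurable lborel" for k
          using test[OF p(1,2)] borel_measurable_integrable by blast
      qed (use g in measurable)
      then show ?thesis
        using test[of "p _"] p by (simp add: LIMSEQ_const_iff)
    qed
  qed
  then show ?thesis by (simp add: g_def)
qed

section \<open>Spectral calculus of the Riesz-Hilbert symbol\<close>

lemma cscalar_scaleR: "cscalar (r *\<^sub>R z) = r *\<^sub>R cscalar z"
  by (rule cclifford_eqI) (simp add: cscalar.rep_eq)

lemma norm_cscalar [simp]: "norm (cscalar z :: 'n::finite cclifford) = norm z"
proof -
  have "norm (cscalar z :: 'n cclifford) = (\<Sum>A::'n set\<in>UNIV. if A = {} then norm z else 0)"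
    unfolding norm_cclifford_def cscalar.rep_eq by (intro sum.cong refl) simp
  then show ?thesis by simp
qed

lemma bounded_linear_cscalar: "bounded_linear cscalar"
  by (rule bounded_linear_intro[where K = 1]) (simp_all add: cscalar_add cscalar_scaleR)

lemma borel_measurable_cscalar [measurable]:
  "f \<in> borel_measurable M \<Longrightarrow> (\<lambda>x. cscalar (f x)) \<in> borel_measurable M"
  using borel_measurable_continuous_onI[OF linear_continuous_on[OF bounded_linear_cscalar]]
  by (rule measurable_compose[rotated])

lemma cscalar_1 [simp]: "cscalar 1 = 1"
  using cscalar_of_real[of 1] by simp

lemma cscalar_mult_mult: "cscalar a * x * (cscalar b * y) = cscalar (a * b) * (x * y)"
proof -
  have "x * (cscalar b * y) = cscalar b * (x * y)"
    by (simp only: mult.assoc[symmetric] cscalar_commute[of b x])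
  then show ?thesis by (simp only: mult.assoc cscalar_mult)
qed

lemma cscalar_minus: "cscalar (- z) = - cscalar z"
  by (rule cclifford_eqI) (simp add: cscalar.rep_eq)

text \<open>For \<open>\<sigma>\<^sup>2 = 1\<close> this is the element \<open>a P\<^sub>+ + b P\<^sub>-\<close> with the complementary idempotents
  \<open>P\<^sub>\<plusminus> = (1 \<plusminus> \<sigma>) / 2\<close>.\<close>

definition spectral :: "'n::finite cclifford \<Rightarrow> complex \<Rightarrow> complex \<Rightarrow> 'n cclifford" where
  "spectral \<sigma> a b = cscalar a * ((1 / 2) *\<^sub>R (1 + \<sigma>)) + cscalar b * ((1 / 2) *\<^sub>R (1 - \<sigma>))"

lemma spectral_1_1: "spectral \<sigma> 1 1 = 1"
  by (simp add: spectral_def algebra_simps flip: scaleR_add_left)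

lemma spectral_1_minus_1: "spectral \<sigma> 1 (- 1) = \<sigma>"
  by (simp add: spectral_def cscalar_minus algebra_simps flip: scaleR_add_left)

lemma spectral_scaleR: "r *\<^sub>R spectral \<sigma> a b = spectral \<sigma> (r *\<^sub>R a) (r *\<^sub>R b)"
  by (simp add: spectral_def cscalar_scaleR scaleR_add_right scaleR_scaleR mult.commute)

lemma cscalar_mult_spectral: "cscalar z * spectral \<sigma> a b = spectral \<sigma> (z * a) (z * b)"
  by (simp add: spectral_def cscalar_mult distrib_left mult.assoc)

lemma spectral_mult:
  fixes \<sigma> :: "'n::finite cclifford"
  assumes "\<sigma> * \<sigma> = 1"
  shows "spectral \<sigma> a b * spectral \<sigma> c d = spectral \<sigma> (a * c) (b * d)"
proof -
  define P Q where "P = (1 / 2 :: real) *\<^sub>R (1 + \<sigma>)" and "Q = (1 / 2 :: real) *\<^sub>R (1 - \<sigma>)"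
  have four: "(1 + \<sigma>) * (1 + \<sigma>) = 2 *\<^sub>R (1 + \<sigma>)" "(1 - \<sigma>) * (1 - \<sigma>) = 2 *\<^sub>R (1 - \<sigma>)"
    "(1 + \<sigma>) * (1 - \<sigma>) = 0" "(1 - \<sigma>) * (1 + \<sigma>) = 0"
    using assms by (simp_all add: algebra_simps scaleR_2)
  have PQ: "P * P = P" "Q * Q = Q" "P * Q = 0" "Q * P = 0"
    unfolding P_def Q_def by (simp_all add: four)
  show ?thesis
    unfolding spectral_def P_def[symmetric] Q_def[symmetric] distrib_left distrib_right cscalar_mult_mult PQ
    by simp
qed

text \<open>Powers act separately on the two coefficients, so the exponential series in the algebra
  splits into two complex ones.\<close>

lemma exp_spectral:
  assumes "\<sigma> * \<sigma> = 1"
  shows "exp (spectral \<sigma> a b) = spectral \<sigma> (exp a) (exp b)"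
proof -
  have pow: "spectral \<sigma> a b ^ n = spectral \<sigma> (a ^ n) (b ^ n)" for n
    by (induction n) (simp_all add: spectral_1_1 spectral_mult[OF assms])
  have "(\<lambda>n. cscalar (a ^ n /\<^sub>R fact n) * ((1 / 2) *\<^sub>R (1 + \<sigma>)) + cscalar (b ^ n /\<^sub>R fact n) * ((1 / 2) *\<^sub>R (1 - \<sigma>)))
      sums (cscalar (exp a) * ((1 / 2) *\<^sub>R (1 + \<sigma>)) + cscalar (exp b) * ((1 / 2) *\<^sub>R (1 - \<sigma>)))"
    by (intro sums_add bounded_linear.sums[OF bounded_linear_compose[OF bounded_linear_mult_left bounded_linear_cscalar]]
        exp_converges)
  then have "(\<lambda>n. spectral \<sigma> a b ^ n /\<^sub>R fact n) sums spectral \<sigma> (exp a) (exp b)"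
    unfolding pow spectral_scaleR by (simp only: spectral_def)
  then show ?thesis
    using exp_converges[of "spectral \<sigma> a b"] sums_unique2 by blast
qed

text \<open>Exchanging the summation indices symmetrises the double sum: twice the square is a sum
  of anticommutators, of which the Clifford relations leave only the diagonal.\<close>

lemma clifford_vec_square:
  fixes \<xi> :: "real ^ 'n::finite"
  shows "clifford_vec \<xi> * clifford_vec \<xi> = - ((norm \<xi>)\<^sup>2 *\<^sub>R 1)"
proof -
  let ?e = "clifford_gen :: 'n \<Rightarrow> 'n cclifford"
  have 1: "clifford_vec \<xi> * clifford_vec \<xi> = (\<Sum>j\<in>UNIV. \<Sum>k\<in>UNIV. (\<xi> $ j * \<xi> $ k) *\<^sub>R (?e j * ?e k))"
    by (simp add: clifford_vec_def sum_product mult_ac)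
  also have "\<dots> = (\<Sum>j\<in>UNIV. \<Sum>k\<in>UNIV. (\<xi> $ j * \<xi> $ k) *\<^sub>R (?e k * ?e j))"
    by (subst sum.swap) (simp add: mult.commute)
  finally have "clifford_vec \<xi> * clifford_vec \<xi> + clifford_vec \<xi> * clifford_vec \<xi> =
      (\<Sum>j\<in>UNIV. \<Sum>k\<in>UNIV. (\<xi> $ j * \<xi> $ k) *\<^sub>R (?e j * ?e k + ?e k * ?e j))"
    using 1 by (simp add: sum.distrib scaleR_add_right)
  also have "\<dots> = (\<Sum>j\<in>UNIV. (\<xi> $ j * \<xi> $ j) *\<^sub>R (- 2))"
    by (simp add: clifford_relations if_distrib cong: if_cong)
  also have "\<dots> = (norm \<xi>)\<^sup>2 *\<^sub>R (- 2)"
    by (simp add: sum_negf scaleR_sum_left power2_norm_eq_inner inner_vec_def)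
  also have "\<dots> = 2 *\<^sub>R (- ((norm \<xi>)\<^sup>2 *\<^sub>R 1) :: 'n cclifford)"
  proof -
    have "(- 2 :: 'n cclifford) = (- 2) *\<^sub>R 1"
      by (simp add: scaleR_conv_of_real)
    then show ?thesis
      by (simp only: scaleR_scaleR scaleR_minus_right scaleR_minus_left mult_minus_right mult.commute)
  qed
  finally have "2 *\<^sub>R (clifford_vec \<xi> * clifford_vec \<xi>) = 2 *\<^sub>R (- ((norm \<xi>)\<^sup>2 *\<^sub>R 1) :: 'n cclifford)"
    by (simp only: scaleR_2)
  then show ?thesis
    by (simp only: scaleR_cancel_left) simp
qed

text \<open>The factor -i contributes the sign that makes the negative square of a vector positive.
  At the origin the symbol is 0 and the identity fails, so the spectral formulas are used only off
  this null set.\<close>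

lemma riesz_hilbert_symbol_square:
  assumes "\<xi> \<noteq> 0"
  shows "riesz_hilbert_symbol \<xi> * riesz_hilbert_symbol \<xi> = (1 :: 'n::finite cclifford)"
proof -
  let ?v = "clifford_vec \<xi> :: 'n cclifford"
  have "cscalar (- \<i>) * ?v * (cscalar (- \<i>) * ?v) = cscalar ((- \<i>) * (- \<i>)) * (?v * ?v)"
    by (rule cscalar_mult_mult)
  also have "\<dots> = (norm \<xi>)\<^sup>2 *\<^sub>R 1"
    by (simp add: clifford_vec_square cscalar_minus)
  finally have "riesz_hilbert_symbol \<xi> * riesz_hilbert_symbol \<xi> =
      inverse (norm \<xi>) *\<^sub>R inverse (norm \<xi>) *\<^sub>R (norm \<xi>)\<^sup>2 *\<^sub>R (1 :: 'n cclifford)"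
    unfolding riesz_hilbert_symbol_def mult_scaleR_left mult_scaleR_right by (rule arg_cong)
  moreover have "inverse (norm \<xi>) * (inverse (norm \<xi>) * (norm \<xi>)\<^sup>2) = 1"
    using assms by (simp add: power2_eq_square field_simps)
  ultimately show ?thesis by (simp only: scaleR_scaleR scaleR_one)
qed

lemma norm_clifford_gen [simp]: "norm (clifford_gen j :: 'n::finite cclifford) = 1"
proof -
  have "norm (clifford_gen j :: 'n cclifford) = (\<Sum>A\<in>UNIV. if A = {j} then 1 else 0)"
    unfolding norm_cclifford_def clifford_gen_def blade.rep_eq by (intro sum.cong refl) simp
  then show ?thesis by simp
qed

text \<open>The norm sums the moduli of the coefficients, so a unit vector need not have norm 1; n
  generators of norm 1 with coefficients at most |\<xi>| give n.\<close>

lemma norm_riesz_hilbert_symbol_le: "norm (riesz_hilbert_symbol \<xi> :: 'n::finite cclifford) \<le> CARD('n)"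
proof -
  have "norm (clifford_vec \<xi> :: 'n cclifford) \<le> (\<Sum>j\<in>(UNIV :: 'n set). norm \<xi>)"
    unfolding clifford_vec_def
    by (rule order_trans[OF norm_sum]) (intro sum_mono, simp add: component_le_norm_cart)
  then have "norm (cscalar (- \<i>) * clifford_vec \<xi> :: 'n cclifford) \<le> CARD('n) * norm \<xi>"
    using norm_mult_ineq[of "cscalar (- \<i>)" "clifford_vec \<xi>"] by simp
  then show ?thesis
    by (cases "\<xi> = 0") (simp_all add: riesz_hilbert_symbol_def field_simps)
qed

lemma borel_measurable_riesz_hilbert_symbol [measurable]:
  "riesz_hilbert_symbol \<in> borel_measurable borel"
  unfolding riesz_hilbert_symbol_def[abs_def] clifford_vec_def by measurable

lemma generator_symbol_eq_spectral:
  assumes "\<xi> \<noteq> 0"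
  shows "generator_symbol \<alpha> \<theta> \<xi> = spectral (riesz_hilbert_symbol \<xi>)
    (exp (\<i> * of_real (pi * \<theta> / 2)) * of_real (norm \<xi> powr \<alpha>))
    (exp (- \<i> * of_real (pi * \<theta> / 2)) * of_real (norm \<xi> powr \<alpha>))"
proof -
  let ?\<sigma> = "riesz_hilbert_symbol \<xi>"
  have "cscalar (\<i> * pi * \<theta> / 2) * ?\<sigma> = spectral ?\<sigma> (\<i> * of_real (pi * \<theta> / 2)) (- \<i> * of_real (pi * \<theta> / 2))"
    using cscalar_mult_spectral[of "\<i> * pi * \<theta> / 2" ?\<sigma> 1 "- 1"] by (simp add: spectral_1_minus_1 mult.assoc)
  then show ?thesis
    by (simp only: generator_symbol_def exp_spectral[OF riesz_hilbert_symbol_square[OF assms]]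
        spectral_scaleR scaleR_conv_of_real[where 'a = complex] mult.commute)
qed

text \<open>Integrating factor: exp (t A) F t has derivative 0. Differentiating the exponential with
  \<open>A\<close> on its right lets the two terms cancel by associativity, whether or not
  \<open>A\<close> commutes with \<open>F t\<close>.\<close>

lemma linear_ode_unique:
  fixes A :: "'a::{real_normed_algebra_1, banach}" and F :: "real \<Rightarrow> 'a"
  assumes cont: "continuous_on {0..} F"
    and deriv: "\<And>t. 0 < t \<Longrightarrow> (F has_vector_derivative - (A * F t)) (at t)"
    and "0 \<le> t"
  shows "F t = exp (- (t *\<^sub>R A)) * F 0"
proof -
  define G where "G t = exp (t *\<^sub>R A) * F t" for t
  have "G t = G 0"
  \<comment> \<open>The derivative is known only for t > 0, so 0 is an exceptional point where
    continuity suffices.\<close>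
  proof (rule has_derivative_zero_unique_strong_convex[of "{0..}" "{0}" G 0 "G 0" t])
    have "continuous_on {0..} (\<lambda>t. exp (t *\<^sub>R A))"
      by (intro continuous_at_imp_continuous_on ballI
          has_vector_derivative_continuous[OF exp_scaleR_has_vector_derivative_right])
    then show "continuous_on {0..} G"
      unfolding G_def using cont by (intro continuous_on_mult)
    fix t :: real assume "t \<in> {0..} - {0}"
    then have t: "0 < t" by auto
    have "(G has_vector_derivative exp (t *\<^sub>R A) * (- (A * F t)) + exp (t *\<^sub>R A) * A * F t) (at t)"
      unfolding G_def
      by (rule has_vector_derivative_mult[OF exp_scaleR_has_vector_derivative_right deriv[OF t]])
    then have "(G has_vector_derivative 0) (at t)"
      by (simp add: mult.assoc)
    then show "(G has_derivative (\<lambda>h. 0)) (at t within {0..})"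
      using has_vector_derivative_at_within[of G 0 t "{0..}"] by (simp add: has_vector_derivative_def)
  qed (use assms in auto)
  then have "exp (t *\<^sub>R A) * F t = F 0"
    by (simp add: G_def)
  then have "exp (- (t *\<^sub>R A)) * exp (t *\<^sub>R A) * F t = exp (- (t *\<^sub>R A)) * F 0"
    by (simp add: mult.assoc)
  moreover have "exp (- (t *\<^sub>R A)) * exp (t *\<^sub>R A) = 1"
    using exp_minus_inverse[of "- (t *\<^sub>R A)"] by simp
  ultimately show ?thesis by simp
qed

section \<open>The Cauchy problem\<close>

lemma inv_fourier_add:
  "\<phi> \<in> schwartz \<Longrightarrow> \<psi> \<in> schwartz \<Longrightarrow>
    inv_fourier (\<lambda>x. \<phi> x + \<psi> x) = (\<lambda>x. inv_fourier \<phi> x + inv_fourier \<psi> x)"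
  by (simp add: inv_fourier_eq_signed_fourier signed_fourier_add distrib_left)

lemma inv_fourier_const_mult: "inv_fourier (\<lambda>x. c * \<phi> x) = (\<lambda>x. c * inv_fourier \<phi> x)"
  by (simp only: inv_fourier_eq_signed_fourier signed_fourier_const_mult mult.left_commute)

lemma schwartz_gaussian: "(\<lambda>x :: real ^ 'n::finite. complex_of_real (exp (- (norm x)\<^sup>2))) \<in> schwartz"
  using polynomial_exp_schwartz[of "\<lambda>_. 1" "\<lambda>x :: real ^ 'n. (norm x)\<^sup>2"]
    real_polynomial_function_norm_square real_polynomial_function.intros(2)[of 1]
  by simp

text \<open>Integrability against one nowhere vanishing test function already forces measurability:
  the product with a Gaussian is measurable, and the Gaussian can be divided out.\<close>

lemma has_fourier_function_measurable:
  assumes "has_fourier_function T (f :: real ^ 'n::finite \<Rightarrow> 'n cclifford)"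
  shows "f \<in> borel_measurable borel"
proof -
  have "integrable lborel (\<lambda>x. f x * cscalar (of_real (exp (- (norm x)\<^sup>2))))"
    by (rule bspec[OF assms[unfolded has_fourier_function_def] schwartz_gaussian, THEN conjunct1])
  then have [measurable]: "(\<lambda>x. exp (- (norm x)\<^sup>2) *\<^sub>R f x) \<in> borel_measurable borel"
    unfolding mult_cscalar_of_real by (auto dest: borel_measurable_integrable)
  have "(\<lambda>x. exp ((norm x)\<^sup>2) *\<^sub>R (exp (- (norm x)\<^sup>2) *\<^sub>R f x)) \<in> borel_measurable borel"
    by measurable
  moreover have "exp ((norm x)\<^sup>2) *\<^sub>R (exp (- (norm x)\<^sup>2) *\<^sub>R f x) = f x" for x
    by (simp add: exp_add[symmetric])
  ultimately show ?thesis by simp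
qed

text \<open>This makes the choice by \<open>SOME\<close> in \<open>fourier_multiplier\<close>
  harmless: representatives differ only on a null set, which integrals do not see.\<close>

lemma has_fourier_function_unique:
  assumes "has_fourier_function T f" "has_fourier_function T g"
  shows "AE x in lborel. f x = g x"
proof -
  have "AE x in lborel. f x - g x = 0"
  proof (rule AE_eq_0_if_schwartz_integrals_eq_0)
    fix \<phi> :: "real ^ 'a \<Rightarrow> complex" assume \<phi>: "\<phi> \<in> schwartz"
    have int: "integrable lborel (\<lambda>x. f x * cscalar (\<phi> x))" "integrable lborel (\<lambda>x. g x * cscalar (\<phi> x))"
      and eq: "(\<integral>x. f x * cscalar (\<phi> x) \<partial>lborel) = (\<integral>x. g x * cscalar (\<phi> x) \<partial>lborel)"
      using assms \<phi> by (simp_all add: has_fourier_function_def regular_dist_def)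
    show "integrable lborel (\<lambda>x. (f x - g x) * cscalar (\<phi> x))"
      using int by (simp add: left_diff_distrib)
    show "(\<integral>x. (f x - g x) * cscalar (\<phi> x) \<partial>lborel) = 0"
      using int eq by (simp add: left_diff_distrib)
  qed
  then show ?thesis by simp
qed

lemma has_fourier_function_apply:
  assumes "has_fourier_function T f" "\<phi> \<in> schwartz"
  shows "T \<phi> = regular_dist f (inv_fourier \<phi>)"
  using assms inv_fourier_schwartz[OF assms(2)] fourier_inv_fourier[OF assms(2)]
  by (auto simp: has_fourier_function_def fourier_dist_def dest: bspec[of _ _ "inv_fourier \<phi>"])

lemma regular_dist_cong_AE:
  assumes "AE x in lborel. f x = g x" "f \<in> borel_measurable borel" "g \<in> borel_measurable borel" "\<phi> \<in> schwartz"
  shows "regular_dist f \<phi> = regular_dist g \<phi>"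
proof -
  have [measurable]: "f \<in> borel_measurable borel" "g \<in> borel_measurable borel" "\<phi> \<in> borel_measurable borel"
    using assms by (auto dest: schwartz_measurable)
  show ?thesis
    unfolding regular_dist_def
  proof (rule integral_cong_AE)
    show "AE x in lborel. f x * cscalar (\<phi> x) = g x * cscalar (\<phi> x)"
      using assms(1) by eventually_elim simp
  qed measurable
qed

lemma integrable_bounded_mult_schwartz:
  fixes f :: "real ^ 'n::finite \<Rightarrow> 'n cclifford"
  assumes "f \<in> borel_measurable borel" "\<And>x. norm (f x) \<le> B" "\<phi> \<in> schwartz"
  shows "integrable lborel (\<lambda>x. f x * cscalar (\<phi> x))"
proof (rule Bochner_Integration.integrable_bound)
  have [measurable]: "f \<in> borel_measurable borel" "\<phi> \<in> borel_measurable borel"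
    using assms by (auto dest: schwartz_measurable)
  show "integrable lborel (\<lambda>x. B * norm (\<phi> x))"
    using schwartz_integrable[OF assms(3)] by (intro integrable_mult_right integrable_norm)
  show "AE x in lborel. norm (f x * cscalar (\<phi> x)) \<le> norm (B * norm (\<phi> x))"
  proof (rule AE_I2)
    fix x
    have "norm (f x * cscalar (\<phi> x)) \<le> norm (f x) * norm (\<phi> x)"
      using norm_mult_ineq[of "f x" "cscalar (\<phi> x)"] by simp
    also have "\<dots> \<le> B * norm (\<phi> x)"
      using assms(2) by (rule mult_right_mono) simp
    finally show "norm (f x * cscalar (\<phi> x)) \<le> norm (B * norm (\<phi> x))" by simp
  qed
  show "(\<lambda>x. f x * cscalar (\<phi> x)) \<in> borel_measurable lborel" by measurable
qed

lemma has_fourier_function_inv_fourier_dist: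
  assumes "f \<in> borel_measurable borel" "\<And>x. norm (f x) \<le> B"
  shows "has_fourier_function (inv_fourier_dist (regular_dist f)) f"
  using integrable_bounded_mult_schwartz[OF assms]
  by (simp add: has_fourier_function_def fourier_dist_def inv_fourier_dist_def inv_fourier_fourier)

text \<open>Of the index 4n, 2n pays for the integrable weight on the right and 2n for the basic
  estimate of the transform by its L1 norm. Integrated, this is the continuity bound for
  distributions given by bounded functions.\<close>

lemma inv_fourier_le_weight:
  "\<exists>C\<ge>0. \<forall>\<phi> :: real ^ 'n::finite \<Rightarrow> complex. \<phi> \<in> schwartz \<longrightarrow> (\<forall>\<xi>. norm (inv_fourier \<phi> \<xi>) \<le>
    C * schwartz_norm (4 * CARD('n)) \<phi> * (1 / (1 + norm \<xi>) ^ (2 * CARD('n))))"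
proof -
  define c where "c = 1 / (2 * pi) ^ CARD('n)"
  define W where "W = weight_mass TYPE('n) * (1 + real CARD('n)) ^ (2 * CARD('n))"
  have c: "0 \<le> c" by (simp add: c_def)
  have "norm (inv_fourier \<phi> \<xi>) \<le> c * W * schwartz_norm (4 * CARD('n)) \<phi> * (1 / (1 + norm \<xi>) ^ (2 * CARD('n)))"
    if "\<phi> \<in> schwartz" for \<phi> :: "real ^ 'n \<Rightarrow> complex" and \<xi>
  proof -
    have "(1 + norm \<xi>) ^ (2 * CARD('n)) * norm (signed_fourier 1 \<phi> \<xi>) \<le> W * schwartz_norm (4 * CARD('n)) \<phi>"
      using signed_fourier_weighted_le[OF _ that, of 1 \<xi> "2 * CARD('n)"] by (simp add: W_def)
    then have "norm (signed_fourier 1 \<phi> \<xi>) \<le> W * schwartz_norm (4 * CARD('n)) \<phi> * (1 / (1 + norm \<xi>) ^ (2 * CARD('n)))"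
      using norm_weight_pos[of \<xi> "2 * CARD('n)"] by (simp add: pos_le_divide_eq mult.commute)
    then have "c * norm (signed_fourier 1 \<phi> \<xi>) \<le> c * (W * schwartz_norm (4 * CARD('n)) \<phi> * (1 / (1 + norm \<xi>) ^ (2 * CARD('n))))"
      using c by (rule mult_left_mono)
    moreover have "norm (inv_fourier \<phi> \<xi>) = c * norm (signed_fourier 1 \<phi> \<xi>)"
      unfolding inv_fourier_eq_signed_fourier norm_mult norm_of_real c_def[symmetric] using c by simp
    ultimately show ?thesis by (simp only: mult.assoc)
  qed
  moreover have "0 \<le> c * W"
    using c weight_mass_nonneg[where 'n = 'n] by (simp add: W_def)
  ultimately show ?thesis by blast
qed

lemma tempered_distribution_inv_fourier_dist:
  fixes f :: "real ^ 'n::finite \<Rightarrow> 'n cclifford"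
  assumes f: "f \<in> borel_measurable borel" "\<And>x. norm (f x) \<le> B"
  shows "tempered_distribution (inv_fourier_dist (regular_dist f))"
  unfolding tempered_distribution_def
proof (intro conjI ballI allI)
  note int = integrable_bounded_mult_schwartz[OF f inv_fourier_schwartz]
  fix \<phi> :: "real ^ 'n \<Rightarrow> complex" assume \<phi>: "\<phi> \<in> schwartz"
  show "inv_fourier_dist (regular_dist f) (\<lambda>x. \<phi> x + \<psi> x) =
      inv_fourier_dist (regular_dist f) \<phi> + inv_fourier_dist (regular_dist f) \<psi>" if \<psi>: "\<psi> \<in> schwartz" for \<psi>
    using int[OF \<phi>] int[OF \<psi>]
    by (simp add: inv_fourier_dist_def regular_dist_def inv_fourier_add[OF \<phi> \<psi>] cscalar_add distrib_left)
  show "inv_fourier_dist (regular_dist f) (\<lambda>x. c * \<phi> x) = cscalar c * inv_fourier_dist (regular_dist f) \<phi>" for c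
  proof -
    have "f x * cscalar (c * z) = cscalar c * (f x * cscalar z)" for x z
      by (metis cscalar_mult cscalar_commute mult.assoc)
    then show ?thesis
      using int[OF \<phi>] by (simp add: inv_fourier_dist_def regular_dist_def inv_fourier_const_mult)
  qed
next
  obtain C where C: "0 \<le> C" "\<And>(\<phi> :: real ^ 'n \<Rightarrow> complex) \<xi>. \<phi> \<in> schwartz \<Longrightarrow>
      norm (inv_fourier \<phi> \<xi>) \<le> C * schwartz_norm (4 * CARD('n)) \<phi> * (1 / (1 + norm \<xi>) ^ (2 * CARD('n)))"
    using inv_fourier_le_weight by blast
  have B: "0 \<le> B" using f(2)[of 0] norm_ge_zero order_trans by blast
  have "norm (inv_fourier_dist (regular_dist f) \<phi>) \<le> B * C * weight_mass TYPE('n) * schwartz_norm (4 * CARD('n)) \<phi>"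
    if \<phi>: "\<phi> \<in> schwartz" for \<phi>
  proof -
    let ?N = "schwartz_norm (4 * CARD('n)) \<phi>"
    have "norm (inv_fourier_dist (regular_dist f) \<phi>) \<le>
        (\<integral>(\<xi> :: real ^ 'n). (B * C * ?N) * (1 / (1 + norm \<xi>) ^ (2 * CARD('n))) \<partial>lborel)"
      unfolding inv_fourier_dist_def regular_dist_def
    proof (rule Bochner_Integration.integral_norm_bound_integral)
      show "integrable lborel (\<lambda>x. f x * cscalar (inv_fourier \<phi> x))"
        by (rule integrable_bounded_mult_schwartz[OF f inv_fourier_schwartz[OF \<phi>]])
      show "integrable lborel (\<lambda>\<xi> :: real ^ 'n. (B * C * ?N) * (1 / (1 + norm \<xi>) ^ (2 * CARD('n))))"
        by (rule integrable_mult_right[OF integrable_norm_weight])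
      fix \<xi>
      have "norm (f \<xi> * cscalar (inv_fourier \<phi> \<xi>)) \<le> norm (f \<xi>) * norm (inv_fourier \<phi> \<xi>)"
        using norm_mult_ineq[of "f \<xi>" "cscalar (inv_fourier \<phi> \<xi>)"] by simp
      also have "\<dots> \<le> B * (C * ?N * (1 / (1 + norm \<xi>) ^ (2 * CARD('n))))"
        by (rule mult_mono[OF f(2) C(2)[OF \<phi>] B norm_ge_zero])
      finally show "norm (f \<xi> * cscalar (inv_fourier \<phi> \<xi>)) \<le> (B * C * ?N) * (1 / (1 + norm \<xi>) ^ (2 * CARD('n)))"
        by (simp only: mult.assoc)
    qed
    also have "\<dots> = B * C * ?N * weight_mass TYPE('n)"
      unfolding weight_mass_def by (rule integral_mult_right_zero)
    finally show ?thesis by (simp only: mult_ac)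
  qed
  then show "\<exists>C N. \<forall>\<phi>\<in>schwartz. norm (inv_fourier_dist (regular_dist f) \<phi>) \<le> C * schwartz_norm N \<phi>"
    by blast
qed

section \<open>Symbols of the kernel and of the solution\<close>

definition kernel_symbol :: "real \<Rightarrow> complex \<Rightarrow> real ^ 'n \<Rightarrow> complex" where
  "kernel_symbol \<alpha> \<tau> \<xi> = exp (- \<tau> * of_real (norm \<xi> powr \<alpha>))"

lemma norm_kernel_symbol_le: "0 \<le> Re \<tau> \<Longrightarrow> norm (kernel_symbol \<alpha> \<tau> \<xi>) \<le> 1"
  by (simp add: kernel_symbol_def)

lemma borel_measurable_kernel_symbol [measurable]:
  "kernel_symbol \<alpha> \<tau> \<in> borel_measurable (borel :: (real ^ 'n::finite) measure)"
  unfolding kernel_symbol_def[abs_def] by measurable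

lemma frac_heat_kernel_eq:
  "frac_heat_kernel \<alpha> \<tau> = inv_fourier_dist (regular_dist (\<lambda>\<xi>. cscalar (kernel_symbol \<alpha> \<tau> \<xi>)))"
  by (simp add: frac_heat_kernel_def kernel_symbol_def)

lemma riesz_hilbert_inv_fourier_dist:
  assumes f: "f \<in> borel_measurable borel" "\<And>x. norm (f x) \<le> B" and \<phi>: "\<phi> \<in> schwartz"
  shows "riesz_hilbert (inv_fourier_dist (regular_dist f)) \<phi> =
    regular_dist (\<lambda>\<xi>. riesz_hilbert_symbol \<xi> * f \<xi>) (inv_fourier \<phi>)"
proof -
  let ?T = "inv_fourier_dist (regular_dist f)"
  \<comment> \<open>The representative used by \<open>fourier_multiplier\<close>, which need agree
    with \<open>f\<close> only almost everywhere.\<close>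
  define g where "g = (SOME g. has_fourier_function ?T g)"
  have Tf: "has_fourier_function ?T f"
    by (rule has_fourier_function_inv_fourier_dist[OF f])
  then have Tg: "has_fourier_function ?T g"
    unfolding g_def by (rule someI[of "has_fourier_function ?T"])
  have [measurable]: "g \<in> borel_measurable borel" "f \<in> borel_measurable borel"
    using has_fourier_function_measurable[OF Tg] f by auto
  have "regular_dist (\<lambda>\<xi>. riesz_hilbert_symbol \<xi> * g \<xi>) (inv_fourier \<phi>) =
      regular_dist (\<lambda>\<xi>. riesz_hilbert_symbol \<xi> * f \<xi>) (inv_fourier \<phi>)"
  proof (rule regular_dist_cong_AE)
    show "AE \<xi> in lborel. riesz_hilbert_symbol \<xi> * g \<xi> = riesz_hilbert_symbol \<xi> * f \<xi>"
      using has_fourier_function_unique[OF Tg Tf] by eventually_elim simp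
  qed (use \<phi> inv_fourier_schwartz in measurable)
  then show ?thesis
    by (simp add: riesz_hilbert_def fourier_multiplier_def inv_fourier_dist_def g_def)
qed

text \<open>The explicit solution on the Fourier side, in spectral form rather than as an
  exponential of the generator: measurability and boundedness are then inherited from the two scalar
  symbols.\<close>

definition solution_symbol :: "real \<Rightarrow> real \<Rightarrow> real \<Rightarrow> real ^ 'n \<Rightarrow> 'n::finite cclifford" where
  "solution_symbol \<alpha> \<theta> t \<xi> = spectral (riesz_hilbert_symbol \<xi>)
     (kernel_symbol \<alpha> (of_real t * exp (\<i> * of_real (pi * \<theta> / 2))) \<xi>)
     (kernel_symbol \<alpha> (of_real t * exp (- \<i> * of_real (pi * \<theta> / 2))) \<xi>)"

lemma solution_symbol_eq_exp:
  assumes "\<xi> \<noteq> 0"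
  shows "solution_symbol \<alpha> \<theta> t \<xi> = exp (- (t *\<^sub>R generator_symbol \<alpha> \<theta> \<xi>))"
proof -
  have "- (t *\<^sub>R generator_symbol \<alpha> \<theta> \<xi>) = (- t) *\<^sub>R generator_symbol \<alpha> \<theta> \<xi>"
    by simp
  then show ?thesis
    unfolding solution_symbol_def generator_symbol_eq_spectral[OF assms] spectral_scaleR
    by (simp add: exp_spectral[OF riesz_hilbert_symbol_square[OF assms]] kernel_symbol_def
        scaleR_conv_of_real mult.assoc)
qed

text \<open>The angle pi \<theta> / 2 stays in [- pi / 2, pi / 2], where the cosine is nonnegative;
  the kernel symbols are therefore bounded by 1 however large |\<xi>| is.\<close>

lemma Re_rotation_nonneg:
  assumes "\<bar>\<theta>\<bar> \<le> 1" "0 \<le> t"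
  shows "0 \<le> Re (of_real t * exp (\<i> * of_real (pi * \<theta> / 2)))" "0 \<le> Re (of_real t * exp (- \<i> * of_real (pi * \<theta> / 2)))"
proof -
  have "- (pi / 2) \<le> pi * \<theta> / 2" "pi * \<theta> / 2 \<le> pi / 2"
    using assms(1) mult_left_mono[of \<theta> 1 pi] mult_left_mono[of "- 1" \<theta> pi] by auto
  then have c: "0 \<le> cos (pi * \<theta> / 2)"
    by (rule cos_ge_zero)
  have Re: "Re (of_real t * exp (\<i> * of_real x)) = t * cos x" "Re (of_real t * exp (- \<i> * of_real x)) = t * cos x" for x
    by (simp_all add: Re_exp)
  show "0 \<le> Re (of_real t * exp (\<i> * of_real (pi * \<theta> / 2)))" "0 \<le> Re (of_real t * exp (- \<i> * of_real (pi * \<theta> / 2)))"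
    unfolding Re by (intro mult_nonneg_nonneg c assms(2))+
qed

lemma solution_symbol_measurable [measurable]:
  "solution_symbol \<alpha> \<theta> t \<in> borel_measurable (borel :: (real ^ 'n::finite) measure)"
  unfolding solution_symbol_def[abs_def] spectral_def by measurable

lemma norm_solution_symbol_le:
  fixes \<xi> :: "real ^ 'n::finite"
  assumes "\<bar>\<theta>\<bar> \<le> 1" "0 \<le> t"
  shows "norm (solution_symbol \<alpha> \<theta> t \<xi> :: 'n cclifford) \<le> 1 + real CARD('n)"
proof -
  let ?\<sigma> = "riesz_hilbert_symbol \<xi> :: 'n cclifford"
  have half: "norm (cscalar z * ((1 / 2) *\<^sub>R R)) \<le> (1 + real CARD('n)) / 2"
    if "norm z \<le> 1" "norm R \<le> 1 + real CARD('n)" for z and R :: "'n cclifford"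
  proof -
    have "norm (cscalar z * ((1 / 2) *\<^sub>R R)) \<le> norm z * (norm R / 2)"
      using norm_mult_ineq[of "cscalar z" "(1 / 2) *\<^sub>R R"] by simp
    also have "\<dots> \<le> 1 * ((1 + real CARD('n)) / 2)"
      using that by (intro mult_mono) auto
    finally show ?thesis by simp
  qed
  have tri: "norm (1 + ?\<sigma>) \<le> 1 + real CARD('n)" "norm (1 - ?\<sigma>) \<le> 1 + real CARD('n)"
    using norm_triangle_ineq[of 1 ?\<sigma>] norm_triangle_ineq4[of 1 ?\<sigma>] norm_riesz_hilbert_symbol_le[of \<xi>] by auto
  have "norm (solution_symbol \<alpha> \<theta> t \<xi> :: 'n cclifford) \<le> (1 + real CARD('n)) / 2 + (1 + real CARD('n)) / 2"
    unfolding solution_symbol_def spectral_def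
    by (intro norm_triangle_mono[OF half half] tri norm_kernel_symbol_le Re_rotation_nonneg assms)
  then show ?thesis by simp
qed

section \<open>Existence and uniqueness of the fundamental solution\<close>

lemma fundamental_solution_exists:
  assumes "\<bar>\<theta>\<bar> \<le> 1"
  shows "fundamental_solution \<alpha> \<theta> (\<lambda>t. inv_fourier_dist (regular_dist (solution_symbol \<alpha> \<theta> t :: real ^ 'n::finite \<Rightarrow> _)))"
  unfolding fundamental_solution_def
proof (intro conjI exI[of _ "solution_symbol \<alpha> \<theta>"] allI impI)
  fix t :: real assume "0 \<le> t"
  note bound = solution_symbol_measurable norm_solution_symbol_le[OF assms this]
  show "tempered_distribution (inv_fourier_dist (regular_dist (solution_symbol \<alpha> \<theta> t :: real ^ 'n \<Rightarrow> _)))"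
    by (rule tempered_distribution_inv_fourier_dist[OF bound])
  show "has_fourier_function (inv_fourier_dist (regular_dist (solution_symbol \<alpha> \<theta> t :: real ^ 'n \<Rightarrow> _))) (solution_symbol \<alpha> \<theta> t)"
    by (rule has_fourier_function_inv_fourier_dist[OF bound])
next
  show "AE \<xi> :: real ^ 'n in lborel. continuous_on {0..} (\<lambda>t. solution_symbol \<alpha> \<theta> t \<xi>) \<and>
      (\<forall>t>0. ((\<lambda>s. solution_symbol \<alpha> \<theta> s \<xi>) has_vector_derivative
        - (generator_symbol \<alpha> \<theta> \<xi> * solution_symbol \<alpha> \<theta> t \<xi>)) (at t)) \<and> solution_symbol \<alpha> \<theta> 0 \<xi> = 1"
    \<comment> \<open>The origin is discarded because the exponential form of the solution rests on
      the symbol squaring to 1.\<close>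
    using AE_lborel_singleton[of 0]
  proof eventually_elim
    fix \<xi> :: "real ^ 'n" assume "\<xi> \<noteq> 0"
    then have eq: "solution_symbol \<alpha> \<theta> t \<xi> = exp (t *\<^sub>R (- generator_symbol \<alpha> \<theta> \<xi>))" for t
      by (simp add: solution_symbol_eq_exp)
    have deriv: "((\<lambda>t. solution_symbol \<alpha> \<theta> t \<xi>) has_vector_derivative
        - generator_symbol \<alpha> \<theta> \<xi> * solution_symbol \<alpha> \<theta> t \<xi>) (at t)" for t
      unfolding eq by (rule exp_scaleR_has_vector_derivative_left)
    then have "continuous_on {0..} (\<lambda>t. solution_symbol \<alpha> \<theta> t \<xi>)"
      by (intro continuous_at_imp_continuous_on ballI) (rule has_vector_derivative_continuous)
    moreover have "solution_symbol \<alpha> \<theta> 0 \<xi> = 1"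
      by (simp add: eq)
    ultimately show "continuous_on {0..} (\<lambda>t. solution_symbol \<alpha> \<theta> t \<xi>) \<and>
      (\<forall>t>0. ((\<lambda>s. solution_symbol \<alpha> \<theta> s \<xi>) has_vector_derivative
        - (generator_symbol \<alpha> \<theta> \<xi> * solution_symbol \<alpha> \<theta> t \<xi>)) (at t)) \<and> solution_symbol \<alpha> \<theta> 0 \<xi> = 1"
      using deriv by simp
  qed
qed

text \<open>Uniqueness for the linear equation at almost every \<xi> identifies \<open>F t\<close>
  with the explicit symbol off a null set; Fourier inversion on test functions recovers
  \<open>\<Phi> t\<close> from \<open>F t\<close>.\<close>

lemma fundamental_solution_eq:
  fixes \<Phi> :: "real \<Rightarrow> 'n::finite cdist"
  assumes "fundamental_solution \<alpha> \<theta> \<Phi>" "0 \<le> t" "\<phi> \<in> schwartz"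
  shows "\<Phi> t \<phi> = regular_dist (solution_symbol \<alpha> \<theta> t) (inv_fourier \<phi>)"
proof -
  obtain F where F: "\<And>t. 0 \<le> t \<Longrightarrow> has_fourier_function (\<Phi> t) (F t)"
    and ode: "AE \<xi> in lborel. continuous_on {0..} (\<lambda>t. F t \<xi>) \<and>
      (\<forall>t>0. ((\<lambda>s. F s \<xi>) has_vector_derivative - (generator_symbol \<alpha> \<theta> \<xi> * F t \<xi>)) (at t)) \<and> F 0 \<xi> = 1"
    using assms(1) unfolding fundamental_solution_def by blast
  have "AE \<xi> in lborel. F t \<xi> = solution_symbol \<alpha> \<theta> t \<xi>"
    using ode AE_lborel_singleton[of 0]
  proof eventually_elim
    fix \<xi> :: "real ^ 'n"
    assume *: "continuous_on {0..} (\<lambda>t. F t \<xi>) \<and>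
      (\<forall>t>0. ((\<lambda>s. F s \<xi>) has_vector_derivative - (generator_symbol \<alpha> \<theta> \<xi> * F t \<xi>)) (at t)) \<and> F 0 \<xi> = 1"
      and "\<xi> \<noteq> 0"
    have "F t \<xi> = exp (- (t *\<^sub>R generator_symbol \<alpha> \<theta> \<xi>)) * F 0 \<xi>"
      by (rule linear_ode_unique[where F = "\<lambda>t. F t \<xi>"]) (use * assms(2) in auto)
    then show "F t \<xi> = solution_symbol \<alpha> \<theta> t \<xi>"
      using * solution_symbol_eq_exp[OF \<open>\<xi> \<noteq> 0\<close>] by simp
  qed
  then show ?thesis
    unfolding has_fourier_function_apply[OF F[OF assms(2)] assms(3)]
    by (intro regular_dist_cong_AE has_fourier_function_measurable[OF F[OF assms(2)]]
        solution_symbol_measurable inv_fourier_schwartz assms(3))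
qed

lemma regular_dist_solution_symbol:
  fixes \<phi> :: "real ^ 'n::finite \<Rightarrow> complex" and \<alpha> \<theta> t :: real
  assumes \<theta>: "\<bar>\<theta>\<bar> \<le> 1" and t: "0 \<le> t" and \<phi>: "\<phi> \<in> schwartz"
  defines "K\<^sub>1 \<equiv> frac_heat_kernel \<alpha> (of_real t * exp (\<i> * of_real (pi * \<theta> / 2))) :: 'n cdist"
    and "K\<^sub>2 \<equiv> frac_heat_kernel \<alpha> (of_real t * exp (- \<i> * of_real (pi * \<theta> / 2))) :: 'n cdist"
  shows "regular_dist (solution_symbol \<alpha> \<theta> t) (inv_fourier \<phi>) =
    (1/2) *\<^sub>R (K\<^sub>1 \<phi> + riesz_hilbert K\<^sub>1 \<phi>) + (1/2) *\<^sub>R (K\<^sub>2 \<phi> - riesz_hilbert K\<^sub>2 \<phi>)"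
proof -
  define k1 :: "real ^ 'n \<Rightarrow> complex" where "k1 = kernel_symbol \<alpha> (of_real t * exp (\<i> * of_real (pi * \<theta> / 2)))"
  define k2 :: "real ^ 'n \<Rightarrow> complex" where "k2 = kernel_symbol \<alpha> (of_real t * exp (- \<i> * of_real (pi * \<theta> / 2)))"
  define \<psi> where "\<psi> = inv_fourier \<phi>"
  have \<psi>: "\<psi> \<in> schwartz" unfolding \<psi>_def using \<phi> by (rule inv_fourier_schwartz)
  let ?\<sigma> = "riesz_hilbert_symbol :: real ^ 'n \<Rightarrow> 'n cclifford"
  have [measurable]: "k1 \<in> borel_measurable borel" "k2 \<in> borel_measurable borel"
    by (simp_all add: k1_def k2_def)
  have le: "norm (k1 \<xi>) \<le> 1" "norm (k2 \<xi>) \<le> 1" for \<xi>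
    unfolding k1_def k2_def by (intro norm_kernel_symbol_le Re_rotation_nonneg \<theta> t)+
  have \<sigma>le: "norm (?\<sigma> \<xi> * cscalar z) \<le> real CARD('n)" if "norm z \<le> 1" for z \<xi>
  proof -
    have "norm (?\<sigma> \<xi> * cscalar z) \<le> norm (?\<sigma> \<xi>) * norm z"
      using norm_mult_ineq[of "?\<sigma> \<xi>" "cscalar z"] by simp
    also have "\<dots> \<le> real CARD('n) * 1"
      using that norm_riesz_hilbert_symbol_le by (intro mult_mono) auto
    finally show ?thesis by simp
  qed
  have int: "integrable lborel (\<lambda>\<xi>. cscalar (k1 \<xi>) * cscalar (\<psi> \<xi>) :: 'n cclifford)"
    "integrable lborel (\<lambda>\<xi>. cscalar (k2 \<xi>) * cscalar (\<psi> \<xi>) :: 'n cclifford)"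
    using le \<psi> by (auto intro!: integrable_bounded_mult_schwartz[where B = 1])
  have int\<sigma>: "integrable lborel (\<lambda>\<xi>. ?\<sigma> \<xi> * cscalar (k1 \<xi>) * cscalar (\<psi> \<xi>))"
    "integrable lborel (\<lambda>\<xi>. ?\<sigma> \<xi> * cscalar (k2 \<xi>) * cscalar (\<psi> \<xi>))"
    using le \<sigma>le \<psi> by (auto intro!: integrable_bounded_mult_schwartz[where B = "real CARD('n)"])
  \<comment> \<open>The central scalars \<open>k1 \<xi>\<close> and \<open>k2 \<xi>\<close> are
    moved to the right of the symbol, to match \<open>riesz_hilbert\<close>, which multiplies from
    the left.\<close>
  have sym: "solution_symbol \<alpha> \<theta> t \<xi> * cscalar (\<psi> \<xi>) =
      (1/2) *\<^sub>R (cscalar (k1 \<xi>) * cscalar (\<psi> \<xi>) + ?\<sigma> \<xi> * cscalar (k1 \<xi>) * cscalar (\<psi> \<xi>)) +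
      (1/2) *\<^sub>R (cscalar (k2 \<xi>) * cscalar (\<psi> \<xi>) - ?\<sigma> \<xi> * cscalar (k2 \<xi>) * cscalar (\<psi> \<xi>))" for \<xi>
    unfolding solution_symbol_def spectral_def k1_def[symmetric] k2_def[symmetric]
    by (simp add: cscalar_commute[of "k1 \<xi>" "?\<sigma> \<xi>"] cscalar_commute[of "k2 \<xi>" "?\<sigma> \<xi>"] algebra_simps)
  have "regular_dist (solution_symbol \<alpha> \<theta> t) \<psi> =
      (1/2) *\<^sub>R (regular_dist (\<lambda>\<xi>. cscalar (k1 \<xi>)) \<psi> + regular_dist (\<lambda>\<xi>. ?\<sigma> \<xi> * cscalar (k1 \<xi>)) \<psi>) +
      (1/2) *\<^sub>R (regular_dist (\<lambda>\<xi>. cscalar (k2 \<xi>)) \<psi> - regular_dist (\<lambda>\<xi>. ?\<sigma> \<xi> * cscalar (k2 \<xi>)) \<psi>)"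
    unfolding regular_dist_def sym using int int\<sigma> by simp
  moreover have "K\<^sub>1 = inv_fourier_dist (regular_dist (\<lambda>\<xi>. cscalar (k1 \<xi>)))" "K\<^sub>2 = inv_fourier_dist (regular_dist (\<lambda>\<xi>. cscalar (k2 \<xi>)))"
    unfolding K\<^sub>1_def K\<^sub>2_def frac_heat_kernel_eq k1_def k2_def by (rule refl)+
  moreover have "riesz_hilbert (inv_fourier_dist (regular_dist (\<lambda>\<xi>. cscalar (k1 \<xi>)))) \<phi> = regular_dist (\<lambda>\<xi>. ?\<sigma> \<xi> * cscalar (k1 \<xi>)) \<psi>"
    "riesz_hilbert (inv_fourier_dist (regular_dist (\<lambda>\<xi>. cscalar (k2 \<xi>)))) \<phi> = regular_dist (\<lambda>\<xi>. ?\<sigma> \<xi> * cscalar (k2 \<xi>)) \<psi>"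
    unfolding \<psi>_def by (rule riesz_hilbert_inv_fourier_dist[where B = 1]; simp add: le \<phi>)+
  ultimately show ?thesis
    by (simp add: inv_fourier_dist_def \<psi>_def)
qed

text \<open>Existence is claimed along with the formula so that the latter is not vacuous; as the
  formula covers every fundamental solution, it also fixes its values on Schwartz functions for t >
  0.\<close>

theorem theorem1:
  fixes m :: nat and \<alpha> \<theta> :: real
  assumes "m \<ge> 1"
    and "2 * real m \<le> \<alpha>" and "\<alpha> < 2 * real m + 2"
    and "\<bar>\<theta>\<bar> \<le> min (\<alpha> - 2 * real m) (2 * real m + 2 - \<alpha>)"
  shows "(\<exists>\<Phi> :: real \<Rightarrow> 'n::finite cdist. fundamental_solution \<alpha> \<theta> \<Phi>) \<and>
    (\<forall>\<Phi> :: real \<Rightarrow> 'n cdist. fundamental_solution \<alpha> \<theta> \<Phi> \<longrightarrow>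
       (\<forall>t>0. \<forall>\<phi>\<in>schwartz.
          (let K\<^sub>1 = frac_heat_kernel \<alpha> (of_real t * exp (\<i> * of_real (pi * \<theta> / 2)));
               K\<^sub>2 = frac_heat_kernel \<alpha> (of_real t * exp (- \<i> * of_real (pi * \<theta> / 2)))
           in \<Phi> t \<phi> = (1/2) *\<^sub>R (K\<^sub>1 \<phi> + riesz_hilbert K\<^sub>1 \<phi>) +
                    (1/2) *\<^sub>R (K\<^sub>2 \<phi> - riesz_hilbert K\<^sub>2 \<phi>))))"
proof (intro conjI allI impI ballI)
  \<comment> \<open>The two entries of the minimum add up to 2, so the smaller is at most 1.\<close>
  have \<theta>: "\<bar>\<theta>\<bar> \<le> 1" using assms(4) by simp
  then show "\<exists>\<Phi> :: real \<Rightarrow> 'n cdist. fundamental_solution \<alpha> \<theta> \<Phi>"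
    using fundamental_solution_exists by blast
  fix \<Phi> :: "real \<Rightarrow> 'n cdist" and t :: real and \<phi> :: "real ^ 'n \<Rightarrow> complex"
  assume "fundamental_solution \<alpha> \<theta> \<Phi>" "0 < t" "\<phi> \<in> schwartz"
  then show "let K\<^sub>1 = frac_heat_kernel \<alpha> (of_real t * exp (\<i> * of_real (pi * \<theta> / 2)));
               K\<^sub>2 = frac_heat_kernel \<alpha> (of_real t * exp (- \<i> * of_real (pi * \<theta> / 2)))
           in \<Phi> t \<phi> = (1/2) *\<^sub>R (K\<^sub>1 \<phi> + riesz_hilbert K\<^sub>1 \<phi>) +
                    (1/2) *\<^sub>R (K\<^sub>2 \<phi> - riesz_hilbert K\<^sub>2 \<phi>)"
    unfolding Let_def
    using fundamental_solution_eq[of \<alpha> \<theta> \<Phi> t \<phi>] regular_dist_solution_symbol[OF \<theta>, where t = t and \<phi> = \<phi> and \<alpha> = \<alpha>] by simp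
qed

end
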